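(* Let $(M,g)$ be a Riemannian manifold with tangent bundle $TM$, and let $m_1,m_2,m_3\in\mathbb{R}$ satisfy $m_1>0$, $m_3>0$ and $m_1m_3-m_2^2>0$. Define $\bar g$ on $TM$ by $$\bar g_{(p,u)}(X^{\bar h},Y^{\bar h})=m_1\,g_p(X,Y),\quad \bar g_{(p,u)}(X^{\bar h},Y^{\bar v})=m_2\,g_p(X,Y),\quad \bar g_{(p,u)}(X^{\bar v},Y^{\bar v})=m_3\,g_p(X,Y)$$ for all $(p,u)\in TM$ and all vector fields $X,Y$ on $M$ (extended symmetrically and bilinearly to each $T_{(p,u)}TM$), where $X^{\bar h}$ and $X^{\bar v}$ denote the horizontal and vertical lifts of $X$. Then $\bar g$ is a Riemannian metric on $TM$.
   Context: $(M,g)$ is an $n$-dimensional Riemannian manifold with Levi-Civita connection $\nabla$, and $\pi:TM\to M$ is the bundle projection; points of $TM$ are pairs $(p,u)$ with $p\in M$, $u\in T_pM$. The connection map $K_{(p,u)}:T_{(p,u)}TM\to T_pM$ of $\nabla$ is $K(\bar X)=d(\exp_p\circ R_{-u}\circ\tau)(\bar X)$, where, for a normal neighborhood $U$ of $p$, $\tau:\pi^{-1}(U)\to T_pM$ is parallel transport of each $Y\in\pi^{-1}(U)$ from $\pi(Y)$ to $p$ (along the geodesic in $U$), and $R_{-u}:T_pM\to T_pM$, $R_{-u}(X)=X-u$; equivalently, $K(dZ(X))=\nabla_XZ$ for a vector field $Z:M\to TM$. The tangent space decomposes as $T_{(p,u)}TM=\mathcal H_{(p,u)}\oplus\mathcal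 V_{(p,u)}$, with $\mathcal H=\ker K$ and $\mathcal V=\ker d\pi$. For a vector field $X$ on $M$, the horizontal lift $X^{\bar h}$ and vertical lift $X^{\bar v}$ are the unique vector fields on $TM$ with $d\pi(X^{\bar h})_{(p,u)}=X_p$, $K(X^{\bar h})_{(p,u)}=0$, and $d\pi(X^{\bar v})_{(p,u)}=0$, $K(X^{\bar v})_{(p,u)}=X_p$. Every $\bar X\in T_{(p,u)}TM$ is the sum of the horizontal lift of $d\pi(\bar X)$ and the vertical lift of $K(\bar X)$. *)

theory Defs
  imports "HOL-Analysis.Analysis"
begin

section \<open>Smooth maps between Euclidean spaces\<close>

text \<open>Used only for open \<open>S\<close>.\<close>

primrec Ck_on :: "nat \<Rightarrow> ('e::euclidean_space \<Rightarrow> 'f::real_normed_vector) \<Rightarrow> 'e set \<Rightarrow> bool" where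
  "Ck_on 0 f S \<longleftrightarrow> continuous_on S f"
| "Ck_on (Suc k) f S \<longleftrightarrow>
     (\<forall>x\<in>S. f differentiable (at x)) \<and>
     (\<forall>v. Ck_on k (\<lambda>x. frechet_derivative f (at x) v) S)"

definition smooth_on :: "('e::euclidean_space \<Rightarrow> 'f::real_normed_vector) \<Rightarrow> 'e set \<Rightarrow> bool" where
  "smooth_on f S \<longleftrightarrow> (\<forall>k. Ck_on k f S)"


section \<open>Smooth manifolds\<close>

text \<open>A chart is a pair \<open>(U, \<phi>)\<close>; the values of \<open>\<phi>\<close> outside \<open>U\<close> are irrelevant. The dimension of the
  manifold is \<open>DIM('e)\<close>. The atlas need not be maximal.\<close>

type_synonym ('a, 'e) chart = "'a set \<times> ('a \<Rightarrow> 'e)"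

record ('a, 'e) manifold =
  mtop :: "'a topology"
  atlas :: "('a, 'e) chart set"

abbreviation points :: "('a, 'e) manifold \<Rightarrow> 'a set" where
  "points M \<equiv> topspace (mtop M)"

definition chart_inv :: "('a, 'e) chart \<Rightarrow> 'e \<Rightarrow> 'a" where
  "chart_inv c = inv_into (fst c) (snd c)"

definition smooth_manifold :: "('a, 'e::euclidean_space) manifold \<Rightarrow> bool" where
  "smooth_manifold M \<longleftrightarrow>
     Hausdorff_space (mtop M) \<and> second_countable (mtop M) \<and>
     (\<Union>c\<in>atlas M. fst c) = points M \<and>
     (\<forall>c\<in>atlas M. openin (mtop M) (fst c) \<and> open (snd c ` fst c) \<and>
        homeomorphic_map (subtopology (mtop M) (fst c)) (top_of_set (snd c ` fst c)) (snd c)) \<and>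
     (\<forall>c\<in>atlas M. \<forall>d\<in>atlas M. smooth_on (snd d \<circ> chart_inv c) (snd c ` (fst c \<inter> fst d)))"

definition smooth_fun :: "('a, 'e::euclidean_space) manifold \<Rightarrow> ('a \<Rightarrow> real) \<Rightarrow> bool" where
  "smooth_fun M f \<longleftrightarrow> (\<forall>c\<in>atlas M. smooth_on (f \<circ> chart_inv c) (snd c ` fst c))"

definition smooth_map ::
  "('a, 'e::euclidean_space) manifold \<Rightarrow> ('b, 'f::euclidean_space) manifold \<Rightarrow> ('a \<Rightarrow> 'b) \<Rightarrow> bool" where
  "smooth_map M N F \<longleftrightarrow>
     continuous_map (mtop M) (mtop N) F \<and>
     (\<forall>c\<in>atlas M. \<forall>d\<in>atlas N.
        smooth_on (snd d \<circ> F \<circ> chart_inv c) (snd c ` (fst c \<inter> F -` fst d)))"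


section \<open>Tangent vectors and the tangent bundle\<close>

text \<open>A tangent vector at \<open>p\<close> is the family of its coordinate representations in the charts around \<open>p\<close>,
  any two of which are related by the derivative of the transition map. It is set to \<open>0\<close> at all
  other charts, so that the family is determined by the tangent vector.\<close>

type_synonym ('a, 'e) tvec = "('a, 'e) chart \<Rightarrow> 'e"

definition tangent_space :: "('a, 'e::euclidean_space) manifold \<Rightarrow> 'a \<Rightarrow> ('a, 'e) tvec set" where
  "tangent_space M p =
     {v. (\<forall>c. \<not> (c \<in> atlas M \<and> p \<in> fst c) \<longrightarrow> v c = 0) \<and>
         (\<forall>c\<in>atlas M. \<forall>d\<in>atlas M. p \<in> fst c \<longrightarrow> p \<in> fst d \<longrightarrow>
            v d = frechet_derivative (snd d \<circ> chart_inv c) (at (snd c p)) (v c))}"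

definition tzero :: "('a, 'e::euclidean_space) tvec" where
  "tzero = (\<lambda>c. 0)"

definition lincomb ::
  "real \<Rightarrow> ('a, 'e::euclidean_space) tvec \<Rightarrow> real \<Rightarrow> ('a, 'e) tvec \<Rightarrow> ('a, 'e) tvec" where
  "lincomb a v b w = (\<lambda>c. a *\<^sub>R v c + b *\<^sub>R w c)"

text \<open>A chart \<open>(U, \<phi>)\<close> of \<open>M\<close> induces the chart \<open>(p, u) \<mapsto> (\<phi> p, d\<phi> u)\<close> of \<open>TM\<close> on \<open>\<pi>\<^sup>-\<^sup>1(U)\<close>.\<close>

definition tb_chart ::
  "('a, 'e::euclidean_space) manifold \<Rightarrow> ('a, 'e) chart \<Rightarrow> ('a \<times> ('a, 'e) tvec, 'e \<times> 'e) chart" where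
  "tb_chart M c = (Sigma (fst c) (tangent_space M), \<lambda>(p, u). (snd c p, u c))"

definition tangent_bundle ::
  "('a, 'e::euclidean_space) manifold \<Rightarrow> ('a \<times> ('a, 'e) tvec, 'e \<times> 'e) manifold" where
  "tangent_bundle M =
     \<lparr> mtop = topology_generated_by
         {{w \<in> fst (tb_chart M c). snd (tb_chart M c) w \<in> W} | c W. c \<in> atlas M \<and> open W},
       atlas = tb_chart M ` atlas M \<rparr>"

definition differential ::
  "('a, 'e::euclidean_space) manifold \<Rightarrow> ('b, 'f::euclidean_space) manifold \<Rightarrow> ('a \<Rightarrow> 'b) \<Rightarrow>
   'a \<Rightarrow> ('a, 'e) tvec \<Rightarrow> ('b, 'f) tvec" where
  "differential M N F p v =
     (THE w. w \<in> tangent_space N (F p) \<and>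
        (\<forall>c\<in>atlas M. \<forall>d\<in>atlas N. p \<in> fst c \<longrightarrow> F p \<in> fst d \<longrightarrow>
           w d = frechet_derivative (snd d \<circ> F \<circ> chart_inv c) (at (snd c p)) (v c)))"

text \<open>The derivative \<open>v(f)\<close> of a function \<open>f\<close> in the direction of a tangent vector \<open>v\<close> at \<open>p\<close>.\<close>

definition dir_deriv ::
  "('a, 'e::euclidean_space) manifold \<Rightarrow> ('a \<Rightarrow> real) \<Rightarrow> 'a \<Rightarrow> ('a, 'e) tvec \<Rightarrow> real" where
  "dir_deriv M f p v =
     (THE r. \<forall>c\<in>atlas M. p \<in> fst c \<longrightarrow>
        r = frechet_derivative (f \<circ> chart_inv c) (at (snd c p)) (v c))"

text \<open>A vector field \<open>X\<close> assigns a tangent vector at \<open>p\<close> to each point \<open>p\<close>; the corresponding section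
  of the tangent bundle is \<open>p \<mapsto> (p, X p)\<close>.\<close>

definition tb_section :: "('a \<Rightarrow> ('a, 'e) tvec) \<Rightarrow> 'a \<Rightarrow> 'a \<times> ('a, 'e) tvec" where
  "tb_section X p = (p, X p)"

definition vector_field ::
  "('a, 'e::euclidean_space) manifold \<Rightarrow> ('a \<Rightarrow> ('a, 'e) tvec) \<Rightarrow> bool" where
  "vector_field M X \<longleftrightarrow>
     (\<forall>p\<in>points M. X p \<in> tangent_space M p) \<and> smooth_map M (tangent_bundle M) (tb_section X)"

definition lie_bracket ::
  "('a, 'e::euclidean_space) manifold \<Rightarrow> ('a \<Rightarrow> ('a, 'e) tvec) \<Rightarrow> ('a \<Rightarrow> ('a, 'e) tvec) \<Rightarrow>
   'a \<Rightarrow> ('a, 'e) tvec" where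
  "lie_bracket M X Y p =
     (THE v. v \<in> tangent_space M p \<and>
        (\<forall>f. smooth_fun M f \<longrightarrow>
           dir_deriv M f p v =
             dir_deriv M (\<lambda>q. dir_deriv M f q (Y q)) p (X p) -
             dir_deriv M (\<lambda>q. dir_deriv M f q (X q)) p (Y p)))"


section \<open>Riemannian metrics and the Levi-Civita connection\<close>

definition sym_bilinear_on ::
  "('a, 'e::euclidean_space) tvec set \<Rightarrow> (('a, 'e) tvec \<Rightarrow> ('a, 'e) tvec \<Rightarrow> real) \<Rightarrow> bool" where
  "sym_bilinear_on V B \<longleftrightarrow>
     (\<forall>v\<in>V. \<forall>w\<in>V. B v w = B w v) \<and>
     (\<forall>v\<in>V. \<forall>v'\<in>V. \<forall>w\<in>V. \<forall>a b. B (lincomb a v b v') w = a * B v w + b * B v' w)"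

definition riemannian_metric ::
  "('a, 'e::euclidean_space) manifold \<Rightarrow> ('a \<Rightarrow> ('a, 'e) tvec \<Rightarrow> ('a, 'e) tvec \<Rightarrow> real) \<Rightarrow> bool" where
  "riemannian_metric M g \<longleftrightarrow>
     (\<forall>p\<in>points M. sym_bilinear_on (tangent_space M p) (g p)) \<and>
     (\<forall>p\<in>points M. \<forall>v\<in>tangent_space M p. v \<noteq> tzero \<longrightarrow> g p v v > 0) \<and>
     (\<forall>X Y. vector_field M X \<longrightarrow> vector_field M Y \<longrightarrow> smooth_fun M (\<lambda>p. g p (X p) (Y p)))"

definition riemannian_manifold ::
  "('a, 'e::euclidean_space) manifold \<Rightarrow> ('a \<Rightarrow> ('a, 'e) tvec \<Rightarrow> ('a, 'e) tvec \<Rightarrow> real) \<Rightarrow> bool" where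
  "riemannian_manifold M g \<longleftrightarrow> smooth_manifold M \<and> riemannian_metric M g"

text \<open>\<open>nabla X Y\<close> stands for \<open>\<nabla>\<^sub>X Y\<close>. Vector fields are only meaningful on \<open>points M\<close>, so all
  equations are required there only.\<close>

definition affine_connection ::
  "('a, 'e::euclidean_space) manifold \<Rightarrow>
   (('a \<Rightarrow> ('a, 'e) tvec) \<Rightarrow> ('a \<Rightarrow> ('a, 'e) tvec) \<Rightarrow> 'a \<Rightarrow> ('a, 'e) tvec) \<Rightarrow> bool" where
  "affine_connection M nabla \<longleftrightarrow>
     (\<forall>X Y. vector_field M X \<longrightarrow> vector_field M Y \<longrightarrow> vector_field M (nabla X Y)) \<and>
     (\<forall>X X' Y f h. vector_field M X \<longrightarrow> vector_field M X' \<longrightarrow> vector_field M Y \<longrightarrow>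
        smooth_fun M f \<longrightarrow> smooth_fun M h \<longrightarrow>
        (\<forall>p\<in>points M. nabla (\<lambda>q. lincomb (f q) (X q) (h q) (X' q)) Y p =
           lincomb (f p) (nabla X Y p) (h p) (nabla X' Y p))) \<and>
     (\<forall>X Y Y'. vector_field M X \<longrightarrow> vector_field M Y \<longrightarrow> vector_field M Y' \<longrightarrow>
        (\<forall>p\<in>points M. nabla X (\<lambda>q. lincomb 1 (Y q) 1 (Y' q)) p =
           lincomb 1 (nabla X Y p) 1 (nabla X Y' p))) \<and>
     (\<forall>X Y f. vector_field M X \<longrightarrow> vector_field M Y \<longrightarrow> smooth_fun M f \<longrightarrow>
        (\<forall>p\<in>points M. nabla X (\<lambda>q. lincomb (f q) (Y q) 0 tzero) p =
           lincomb (dir_deriv M f p (X p)) (Y p) (f p) (nabla X Y p)))"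

definition levi_civita ::
  "('a, 'e::euclidean_space) manifold \<Rightarrow> ('a \<Rightarrow> ('a, 'e) tvec \<Rightarrow> ('a, 'e) tvec \<Rightarrow> real) \<Rightarrow>
   (('a \<Rightarrow> ('a, 'e) tvec) \<Rightarrow> ('a \<Rightarrow> ('a, 'e) tvec) \<Rightarrow> 'a \<Rightarrow> ('a, 'e) tvec) \<Rightarrow> bool" where
  "levi_civita M g nabla \<longleftrightarrow>
     affine_connection M nabla \<and>
     (\<forall>X Y. vector_field M X \<longrightarrow> vector_field M Y \<longrightarrow>
        (\<forall>p\<in>points M. lincomb 1 (nabla X Y p) (-1) (nabla Y X p) = lie_bracket M X Y p)) \<and>
     (\<forall>X Y Z. vector_field M X \<longrightarrow> vector_field M Y \<longrightarrow> vector_field M Z \<longrightarrow>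
        (\<forall>p\<in>points M. dir_deriv M (\<lambda>q. g q (Y q) (Z q)) p (X p) =
           g p (nabla X Y p) (Z p) + g p (Y p) (nabla X Z p)))"


section \<open>The connection map and the lifts\<close>

text \<open>The connection map \<open>K\<close> at \<open>(p, u)\<close> is the linear map from the tangent space of \<open>TM\<close> at \<open>(p, u)\<close>
  to that of \<open>M\<close> at \<open>p\<close> with \<open>K (dZ (X)) = \<nabla>\<^sub>X Z\<close> for all vector fields \<open>X\<close>, \<open>Z\<close> with \<open>Z p = u\<close>.
  Such vectors \<open>dZ (X)\<close> span the tangent space of \<open>TM\<close>, so this determines \<open>K\<close> there; elsewhere it is
  \<open>undefined\<close> by extensionality.\<close>

definition connection_map ::
  "('a, 'e::euclidean_space) manifold \<Rightarrow>
   (('a \<Rightarrow> ('a, 'e) tvec) \<Rightarrow> ('a \<Rightarrow> ('a, 'e) tvec) \<Rightarrow> 'a \<Rightarrow> ('a, 'e) tvec) \<Rightarrow>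
   'a \<times> ('a, 'e) tvec \<Rightarrow> ('a \<times> ('a, 'e) tvec, 'e \<times> 'e) tvec \<Rightarrow> ('a, 'e) tvec" where
  "connection_map M nabla = (\<lambda>(p, u).
     THE K. K \<in> tangent_space (tangent_bundle M) (p, u) \<rightarrow>\<^sub>E tangent_space M p \<and>
       (\<forall>\<xi>\<in>tangent_space (tangent_bundle M) (p, u).
          \<forall>\<eta>\<in>tangent_space (tangent_bundle M) (p, u).
            \<forall>a b. K (lincomb a \<xi> b \<eta>) = lincomb a (K \<xi>) b (K \<eta>)) \<and>
       (\<forall>X Z. vector_field M X \<longrightarrow> vector_field M Z \<longrightarrow> Z p = u \<longrightarrow>
          K (differential M (tangent_bundle M) (tb_section Z) p (X p)) = nabla X Z p))"

text \<open>The differential of the bundle projection \<open>\<pi> = fst\<close>.\<close>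

definition dproj ::
  "('a, 'e::euclidean_space) manifold \<Rightarrow> 'a \<times> ('a, 'e) tvec \<Rightarrow>
   ('a \<times> ('a, 'e) tvec, 'e \<times> 'e) tvec \<Rightarrow> ('a, 'e) tvec" where
  "dproj M w = differential (tangent_bundle M) M fst w"

definition hlift ::
  "('a, 'e::euclidean_space) manifold \<Rightarrow>
   (('a \<Rightarrow> ('a, 'e) tvec) \<Rightarrow> ('a \<Rightarrow> ('a, 'e) tvec) \<Rightarrow> 'a \<Rightarrow> ('a, 'e) tvec) \<Rightarrow>
   ('a \<Rightarrow> ('a, 'e) tvec) \<Rightarrow> 'a \<times> ('a, 'e) tvec \<Rightarrow> ('a \<times> ('a, 'e) tvec, 'e \<times> 'e) tvec" where
  "hlift M nabla X w =
     (THE \<xi>. \<xi> \<in> tangent_space (tangent_bundle M) w \<and>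
        dproj M w \<xi> = X (fst w) \<and> connection_map M nabla w \<xi> = tzero)"

definition vlift ::
  "('a, 'e::euclidean_space) manifold \<Rightarrow>
   (('a \<Rightarrow> ('a, 'e) tvec) \<Rightarrow> ('a \<Rightarrow> ('a, 'e) tvec) \<Rightarrow> 'a \<Rightarrow> ('a, 'e) tvec) \<Rightarrow>
   ('a \<Rightarrow> ('a, 'e) tvec) \<Rightarrow> 'a \<times> ('a, 'e) tvec \<Rightarrow> ('a \<times> ('a, 'e) tvec, 'e \<times> 'e) tvec" where
  "vlift M nabla X w =
     (THE \<xi>. \<xi> \<in> tangent_space (tangent_bundle M) w \<and>
        dproj M w \<xi> = tzero \<and> connection_map M nabla w \<xi> = X (fst w))"

text \<open>The defining conditions of the metric on the tangent bundle; positivity and smoothness are not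
  part of them.\<close>

definition lift_metric ::
  "('a, 'e::euclidean_space) manifold \<Rightarrow> ('a \<Rightarrow> ('a, 'e) tvec \<Rightarrow> ('a, 'e) tvec \<Rightarrow> real) \<Rightarrow>
   (('a \<Rightarrow> ('a, 'e) tvec) \<Rightarrow> ('a \<Rightarrow> ('a, 'e) tvec) \<Rightarrow> 'a \<Rightarrow> ('a, 'e) tvec) \<Rightarrow>
   real \<Rightarrow> real \<Rightarrow> real \<Rightarrow>
   ('a \<times> ('a, 'e) tvec \<Rightarrow> ('a \<times> ('a, 'e) tvec, 'e \<times> 'e) tvec \<Rightarrow>
      ('a \<times> ('a, 'e) tvec, 'e \<times> 'e) tvec \<Rightarrow> real) \<Rightarrow> bool" where
  "lift_metric M g nabla m1 m2 m3 gbar \<longleftrightarrow>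
     (\<forall>w\<in>points (tangent_bundle M).
        sym_bilinear_on (tangent_space (tangent_bundle M) w) (gbar w) \<and>
        (\<forall>X Y. vector_field M X \<longrightarrow> vector_field M Y \<longrightarrow>
           gbar w (hlift M nabla X w) (hlift M nabla Y w) = m1 * g (fst w) (X (fst w)) (Y (fst w)) \<and>
           gbar w (hlift M nabla X w) (vlift M nabla Y w) = m2 * g (fst w) (X (fst w)) (Y (fst w)) \<and>
           gbar w (vlift M nabla X w) (vlift M nabla Y w) = m3 * g (fst w) (X (fst w)) (Y (fst w))))"

end

theory Submission
  imports Defs
begin

text \<open>In the coordinates of a chart \<open>c\<close>, a tangent vector \<open>\<xi>\<close> of \<open>TM\<close> at \<open>(p, u)\<close> is a pair \<open>(a, b)\<close>, and
  \<open>d\<pi> \<xi> = a\<close>, \<open>K \<xi> = b + \<Gamma> a u\<close> with the Christoffel symbols \<open>\<Gamma>\<close> of the connection. Hence \<open>(d\<pi>, K)\<close> is an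
  isomorphism onto two copies of the tangent space of \<open>M\<close>, so the lifts exist and the defining equations
  force \<open>gbar = m1 g(d\<pi>, d\<pi>) + m2 (g(d\<pi>, K) + g(K, d\<pi>)) + m3 g(K, K)\<close>. Positivity is that of the matrix with
  entries \<open>m1, m2, m2, m3\<close>, and smoothness follows from the coordinate formulas. Both \<open>\<Gamma>\<close> and the
  coefficients of \<open>g\<close> are extracted from the global data by cutting off coordinate vector fields with
  bump functions.\<close>

section \<open>Calculus of smooth maps between Euclidean spaces\<close>

text \<open>The connection is known only as an operator on global vector fields, and no axiom says
  that it is local. A bump function is \<open>1\<close> only on a small neighbourhood, not on a
  whole chart, so \<Gamma> at a point is computed with a cutoff made for that point, and the results
  are glued because their values do not depend on the cutoff. The differential, the directional
  derivative, the connection map and the lifts are definite descriptions; each carries information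
  only once existence and uniqueness are proved. For the connection map uniqueness is delicate,
  since a nonzero vertical vector is never of the form \<open>dZ (X)\<close>. In return it spares
  the transformation law of \<Gamma>: the formulas in all charts describe the same map. In
  coordinates \<open>(x, y)\<close> of the bundle, \<open>dproj\<close> and
  \<open>connection_map\<close> of a field are built from the coordinates of the field, the fibre
  coordinate \<open>y\<close> and \<Gamma> at \<open>x\<close>; this is what makes the new metric
  smooth.\<close>

lemma Ck_on_cong_imp:
  assumes "open S" "\<And>x. x \<in> S \<Longrightarrow> f x = g x" "Ck_on k f S"
  shows "Ck_on k g S"
  using assms(2,3)
proof (induction k arbitrary: f g)
  case 0
  then show ?case by (simp cong: continuous_on_cong)
next
  case (Suc k)
  have D: "frechet_derivative f (at x) = frechet_derivative g (at x)" if "x \<in> S" for x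
    using Suc.prems that assms(1)
    by (intro frechet_derivative_transform_within_open[where X=S]) auto
  have "g differentiable (at x)" if "x \<in> S" for x
  proof -
    have "(f has_derivative frechet_derivative f (at x)) (at x)"
      using Suc.prems that by (simp add: frechet_derivative_works)
    then have "(g has_derivative frechet_derivative f (at x)) (at x)"
      using has_derivative_transform_within_open[OF _ assms(1) that] Suc.prems(1) by blast
    then show ?thesis by (auto simp: differentiable_def)
  qed
  moreover have "Ck_on k (\<lambda>x. frechet_derivative g (at x) v) S" for v
    using Suc.IH[of "\<lambda>x. frechet_derivative f (at x) v" "\<lambda>x. frechet_derivative g (at x) v"] D Suc.prems
    by simp
  ultimately show ?case by simp
qed

text \<open>Frees the inductions below from the choice operator in
  \<open>frechet_derivative\<close>: an explicit derivative may be supplied, and by uniqueness it is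
  the chosen one.\<close>

lemma Ck_on_Suc_derivative:
  assumes "open S" "\<And>x. x \<in> S \<Longrightarrow> (f has_derivative f' x) (at x)" "\<And>v. Ck_on k (\<lambda>x. f' x v) S"
  shows "Ck_on (Suc k) f S"
proof -
  have "f' x = frechet_derivative f (at x)" if "x \<in> S" for x
    using assms(2)[OF that] by (rule frechet_derivative_at)
  then have "Ck_on k (\<lambda>x. frechet_derivative f (at x) v) S" for v
    using Ck_on_cong_imp[OF assms(1) _ assms(3)] by simp
  moreover have "f differentiable (at x)" if "x \<in> S" for x
    using assms(2)[OF that] by (rule differentiableI)
  ultimately show ?thesis by simp
qed

text \<open>The product and chain rules leave undifferentiated factors next to derivatives; these
  must be lowered by one order before the induction hypothesis applies.\<close>

lemma Ck_on_SucD: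
  assumes "Ck_on (Suc k) f S"
  shows "Ck_on k f S"
  using assms
proof (induction k arbitrary: f)
  case 0
  then show ?case
    unfolding Ck_on.simps
    by (meson continuous_at_imp_continuous_on differentiable_imp_continuous_within)
next
  case (Suc k)
  then show ?case unfolding Ck_on.simps(2)[of "Suc k"] Ck_on.simps(2)[of k f] by blast
qed

lemma Ck_on_subset:
  assumes "Ck_on k f S" "T \<subseteq> S"
  shows "Ck_on k f T"
  using assms by (induction k arbitrary: f) (auto intro: continuous_on_subset)

text \<open>Continuity and derivatives at a point are decided on any open set around it, so the
  neighbourhoods may even leave \<open>S\<close>.\<close>

lemma Ck_on_locally:
  assumes "\<And>x. x \<in> S \<Longrightarrow> \<exists>T. open T \<and> x \<in> T \<and> Ck_on k f T"
  shows "Ck_on k f S"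
  using assms
proof (induction k arbitrary: f)
  case 0
  have "continuous (at x) f" if "x \<in> S" for x
    using 0[OF that] continuous_on_eq_continuous_at by auto
  then show ?case by (simp add: continuous_at_imp_continuous_on)
next
  case (Suc k)
  have "Ck_on k (\<lambda>x. frechet_derivative f (at x) v) S" for v
    by (rule Suc.IH) (metis Suc.prems Ck_on.simps(2))
  moreover have "f differentiable (at x)" if "x \<in> S" for x
    using Suc.prems[OF that] by auto
  ultimately show ?case by simp
qed

lemma Ck_on_const: "Ck_on k (\<lambda>x. c) S"
  by (induction k arbitrary: c) auto

lemma Ck_on_bounded_linear:
  assumes "bounded_linear L" "open S" "Ck_on k f S"
  shows "Ck_on k (\<lambda>x. L (f x)) S"
  using assms(3)
proof (induction k arbitrary: f)
  case 0
  then show ?case using assms(1) by (simp add: bounded_linear.continuous_on)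
next
  case (Suc k)
  show ?case
  proof (rule Ck_on_Suc_derivative[OF assms(2)])
    show "((\<lambda>x. L (f x)) has_derivative (\<lambda>v. L (frechet_derivative f (at x) v))) (at x)" if "x \<in> S" for x
      using Suc.prems that
      by (intro bounded_linear.has_derivative[OF assms(1)]) (simp add: frechet_derivative_works[symmetric])
    show "Ck_on k (\<lambda>x. L (frechet_derivative f (at x) v)) S" for v
      using Suc by simp
  qed
qed

lemma Ck_on_id: "open S \<Longrightarrow> Ck_on k (\<lambda>x. x) S"
proof (induction k)
  case (Suc k)
  show ?case
    by (rule Ck_on_Suc_derivative[where f' = "\<lambda>x v. v"]) (use Suc in \<open>auto intro: Ck_on_const\<close>)
qed auto

lemma Ck_on_add:
  assumes "open S" "Ck_on k f S" "Ck_on k g S"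
  shows "Ck_on k (\<lambda>x. f x + g x) S"
  using assms(2,3)
proof (induction k arbitrary: f g)
  case 0
  then show ?case by (simp add: continuous_on_add)
next
  case (Suc k)
  show ?case
  proof (rule Ck_on_Suc_derivative[OF assms(1)])
    show "((\<lambda>x. f x + g x) has_derivative
        (\<lambda>v. frechet_derivative f (at x) v + frechet_derivative g (at x) v)) (at x)" if "x \<in> S" for x
      using Suc.prems that by (intro has_derivative_add) (simp_all add: frechet_derivative_works[symmetric])
  qed (use Suc in simp)
qed

text \<open>One induction for products, scalar multiples and inner products: the product rule has
  the same shape for all of them.\<close>

lemma Ck_on_bilinear:
  assumes "bounded_bilinear B" "open S" "Ck_on k f S" "Ck_on k g S"
  shows "Ck_on k (\<lambda>x. B (f x) (g x)) S"
  using assms(3,4)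
proof (induction k arbitrary: f g)
  case 0
  then show ?case using assms(1) by (simp add: bounded_bilinear.continuous_on)
next
  case (Suc k)
  show ?case
  proof (rule Ck_on_Suc_derivative[OF assms(2)])
    show "((\<lambda>x. B (f x) (g x)) has_derivative
        (\<lambda>v. B (f x) (frechet_derivative g (at x) v) + B (frechet_derivative f (at x) v) (g x))) (at x)"
      if "x \<in> S" for x
      using Suc.prems that
      by (intro bounded_bilinear.FDERIV[OF assms(1)]) (simp_all add: frechet_derivative_works[symmetric])
    show "Ck_on k (\<lambda>x. B (f x) (frechet_derivative g (at x) v) + B (frechet_derivative f (at x) v) (g x)) S"
      for v
      using Suc.prems Ck_on_SucD[OF Suc.prems(1)] Ck_on_SucD[OF Suc.prems(2)]
      by (intro Ck_on_add[OF assms(2)] Suc.IH) auto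
  qed
qed

lemma Ck_on_sum:
  assumes "open S" "\<And>i. i \<in> I \<Longrightarrow> Ck_on k (f i) S"
  shows "Ck_on k (\<lambda>x. \<Sum>i\<in>I. f i x) S"
  using assms(2)
  by (induction I rule: infinite_finite_induct) (auto intro: Ck_on_const Ck_on_add[OF assms(1)])

lemma linear_eq_sum_Basis:
  fixes F :: "'a::euclidean_space \<Rightarrow> 'b::real_vector"
  assumes "linear F"
  shows "F v = (\<Sum>i\<in>Basis. (v \<bullet> i) *\<^sub>R F i)"
proof -
  have "F v = F (\<Sum>i\<in>Basis. (v \<bullet> i) *\<^sub>R i)" by (simp add: euclidean_representation)
  also have "\<dots> = (\<Sum>i\<in>Basis. (v \<bullet> i) *\<^sub>R F i)"
    by (simp add: linear_sum[OF assms] linear_cmul[OF assms])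
  finally show ?thesis .
qed

lemma Ck_on_compose:
  assumes "open S" "open T" "f ` S \<subseteq> T" "Ck_on k f S" "Ck_on k g T"
  shows "Ck_on k (\<lambda>x. g (f x)) S"
  using assms(4,5)
proof (induction k arbitrary: g)
  case 0
  then show ?case using assms(3) by (auto intro: continuous_on_compose2)
next
  case (Suc k)
  define g' where "g' y = frechet_derivative g (at y)" for y
  define f' where "f' x = frechet_derivative f (at x)" for x
  have g': "(g has_derivative g' y) (at y)" if "y \<in> T" for y
    using Suc.prems(2) that by (simp add: g'_def frechet_derivative_works[symmetric])
  have f': "(f has_derivative f' x) (at x)" if "x \<in> S" for x
    using Suc.prems(1) that by (simp add: f'_def frechet_derivative_works[symmetric])
  show ?case
  proof (rule Ck_on_Suc_derivative[OF assms(1), where f' = "\<lambda>x v. g' (f x) (f' x v)"])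
    show "((\<lambda>x. g (f x)) has_derivative (\<lambda>v. g' (f x) (f' x v))) (at x)" if "x \<in> S" for x
      using f'[OF that] g' assms(3) that diff_chain_at[of f "f' x" x g "g' (f x)"] by (auto simp: o_def)
    have g'c: "Ck_on k (\<lambda>x. g' (f x) i) S" for i
      using Suc.IH[of "\<lambda>y. g' y i"] Suc.prems Ck_on_SucD[OF Suc.prems(1)] by (simp add: g'_def)
    have f'c: "Ck_on k (\<lambda>x. f' x v \<bullet> i) S" for v i
      using Suc.prems(1) by (intro Ck_on_bounded_linear[OF bounded_linear_inner_left assms(1)]) (simp add: f'_def)
    \<comment> \<open>The chain rule applies \<open>g' (f x)\<close> to the moving vector
      \<open>f' x v\<close>, whereas the induction hypothesis covers only fixed directions; hence
      the expansion in the basis.\<close>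
    have "Ck_on k (\<lambda>x. \<Sum>i\<in>Basis. (f' x v \<bullet> i) *\<^sub>R g' (f x) i) S" for v
      by (intro Ck_on_sum assms(1) Ck_on_bilinear[OF bounded_bilinear_scaleR] g'c f'c)
    moreover have "(\<Sum>i\<in>Basis. (f' x v \<bullet> i) *\<^sub>R g' (f x) i) = g' (f x) (f' x v)" if "x \<in> S" for x v
      using linear_eq_sum_Basis[OF has_derivative_linear[OF g'], of "f x" "f' x v"] assms(3) that by auto
    ultimately show "Ck_on k (\<lambda>x. g' (f x) (f' x v)) S" for v
      by (rule Ck_on_cong_imp[OF assms(1), rotated]) auto
  qed
qed

section \<open>Closure rules for smooth maps\<close>

lemma smooth_on_cong:
  assumes "open S" "\<And>x. x \<in> S \<Longrightarrow> f x = g x" "smooth_on f S"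
  shows "smooth_on g S"
  unfolding smooth_on_def
  using assms(3) Ck_on_cong_imp[OF assms(1,2)] by (simp add: smooth_on_def)

lemma smooth_on_subset: "smooth_on f S \<Longrightarrow> T \<subseteq> S \<Longrightarrow> smooth_on f T"
  by (auto simp: smooth_on_def intro: Ck_on_subset)

lemma smooth_on_locally:
  assumes "\<And>x. x \<in> S \<Longrightarrow> \<exists>T. open T \<and> x \<in> T \<and> smooth_on f T"
  shows "smooth_on f S"
  unfolding smooth_on_def by (intro allI Ck_on_locally) (metis assms smooth_on_def)

lemma smooth_on_const: "smooth_on (\<lambda>x. c) S"
  by (simp add: smooth_on_def Ck_on_const)

lemma smooth_on_id: "open S \<Longrightarrow> smooth_on (\<lambda>x. x) S"
  by (simp add: smooth_on_def Ck_on_id)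

lemma smooth_on_bounded_linear:
  "bounded_linear L \<Longrightarrow> open S \<Longrightarrow> smooth_on f S \<Longrightarrow> smooth_on (\<lambda>x. L (f x)) S"
  by (simp add: smooth_on_def Ck_on_bounded_linear)

lemma smooth_on_add:
  "open S \<Longrightarrow> smooth_on f S \<Longrightarrow> smooth_on g S \<Longrightarrow> smooth_on (\<lambda>x. f x + g x) S"
  by (simp add: smooth_on_def Ck_on_add)

lemma smooth_on_bilinear:
  "bounded_bilinear B \<Longrightarrow> open S \<Longrightarrow> smooth_on f S \<Longrightarrow> smooth_on g S \<Longrightarrow> smooth_on (\<lambda>x. B (f x) (g x)) S"
  by (simp add: smooth_on_def Ck_on_bilinear)

lemma smooth_on_sum:
  "open S \<Longrightarrow> (\<And>i. i \<in> I \<Longrightarrow> smooth_on (f i) S) \<Longrightarrow> smooth_on (\<lambda>x. \<Sum>i\<in>I. f i x) S"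
  by (simp add: smooth_on_def Ck_on_sum)

lemma smooth_on_compose:
  "open S \<Longrightarrow> open T \<Longrightarrow> f ` S \<subseteq> T \<Longrightarrow> smooth_on f S \<Longrightarrow> smooth_on g T \<Longrightarrow> smooth_on (\<lambda>x. g (f x)) S"
  by (simp add: smooth_on_def Ck_on_compose)

lemmas smooth_on_scaleR = smooth_on_bilinear[OF bounded_bilinear_scaleR]
lemmas smooth_on_mult = smooth_on_bilinear[OF bounded_bilinear_mult]
lemmas smooth_on_inner_left = smooth_on_bounded_linear[OF bounded_linear_inner_left]

lemma smooth_on_Pair:
  assumes "open S" "smooth_on f S" "smooth_on g S"
  shows "smooth_on (\<lambda>x. (f x, g x)) S"
proof -
  have "smooth_on (\<lambda>x. (f x, 0) + (0, g x)) S"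
    by (intro smooth_on_add assms smooth_on_bounded_linear[OF _ assms(1,2)]
        smooth_on_bounded_linear[OF _ assms(1,3)] bounded_linear_Pair bounded_linear_zero bounded_linear_ident)
  then show ?thesis by simp
qed

lemma smooth_on_imp_differentiable: "smooth_on f S \<Longrightarrow> x \<in> S \<Longrightarrow> f differentiable (at x)"
  unfolding smooth_on_def by (metis Ck_on.simps(2))

lemma smooth_on_imp_has_derivative:
  "smooth_on f S \<Longrightarrow> x \<in> S \<Longrightarrow> (f has_derivative frechet_derivative f (at x)) (at x)"
  using smooth_on_imp_differentiable frechet_derivative_works by blast

lemma smooth_on_imp_continuous_on: "smooth_on f S \<Longrightarrow> continuous_on S f"
  unfolding smooth_on_def by (metis Ck_on.simps(1))

lemma smooth_on_frechet_derivative: "smooth_on f S \<Longrightarrow> smooth_on (\<lambda>x. frechet_derivative f (at x) v) S"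
  unfolding smooth_on_def by (metis Ck_on.simps(2))

text \<open>Derivatives and Christoffel symbols are known to be smooth in the base point for fixed
  arguments only; expanding in the basis lets the argument vary smoothly as well.\<close>

lemma smooth_on_linear_family:
  fixes L :: "'c::euclidean_space \<Rightarrow> 'a::euclidean_space \<Rightarrow> 'b::real_normed_vector"
  assumes "open S" "\<And>x. x \<in> S \<Longrightarrow> linear (L x)" "\<And>i. i \<in> Basis \<Longrightarrow> smooth_on (\<lambda>x. L x i) S"
    "smooth_on a S"
  shows "smooth_on (\<lambda>x. L x (a x)) S"
proof -
  have "smooth_on (\<lambda>x. \<Sum>i\<in>Basis. (a x \<bullet> i) *\<^sub>R L x i) S"
    by (intro smooth_on_sum smooth_on_scaleR smooth_on_inner_left assms)
  then show ?thesis
    by (rule smooth_on_cong[OF assms(1), rotated]) (metis assms(2) linear_eq_sum_Basis)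
qed

lemma smooth_on_bilinear_family:
  fixes H :: "'c::euclidean_space \<Rightarrow> 'a::euclidean_space \<Rightarrow> 'b::euclidean_space \<Rightarrow> 'd::real_normed_vector"
  assumes "open S" "\<And>x. x \<in> S \<Longrightarrow> bilinear (H x)" "\<And>i j. smooth_on (\<lambda>x. H x i j) S"
    "smooth_on a S" "smooth_on b S"
  shows "smooth_on (\<lambda>x. H x (a x) (b x)) S"
proof (rule smooth_on_linear_family[OF assms(1) _ _ assms(5)])
  show "linear (H x (a x))" if "x \<in> S" for x
    using assms(2)[OF that] by (simp add: bilinear_def)
  show "smooth_on (\<lambda>x. H x (a x) i) S" for i
    by (rule smooth_on_linear_family[OF assms(1) _ _ assms(4)])
       (use assms(2,3) in \<open>auto simp: bilinear_def\<close>)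
qed

lemma smooth_on_frechet_derivative_apply:
  assumes "open S" "smooth_on f S" "smooth_on a S"
  shows "smooth_on (\<lambda>x. frechet_derivative f (at x) (a x)) S"
  by (rule smooth_on_linear_family[OF assms(1) _ _ assms(3)])
     (use assms in \<open>auto intro: linear_frechet_derivative smooth_on_imp_differentiable
        smooth_on_frechet_derivative\<close>)

text \<open>Both functions have the same derivatives at \<open>x\<close>, and
  \<open>frechet_derivative\<close> is a choice from these; so the equation holds even where no
  derivative exists.\<close>

lemma frechet_derivative_cong:
  assumes "open S" "x \<in> S" "\<And>y. y \<in> S \<Longrightarrow> f y = g y"
  shows "frechet_derivative f (at x) = frechet_derivative g (at x)"
proof -
  have "(f has_derivative D) (at x) \<longleftrightarrow> (g has_derivative D) (at x)" for D
    using has_derivative_transform_within_open[OF _ assms(1,2)] assms(3) by metis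
  then show ?thesis by (simp add: frechet_derivative_def)
qed

lemma frechet_derivative_chain:
  assumes "f differentiable (at x)" "g differentiable (at (f x))"
  shows "frechet_derivative (\<lambda>x. g (f x)) (at x) v =
    frechet_derivative g (at (f x)) (frechet_derivative f (at x) v)"
  using frechet_derivative_compose[OF assms] by (simp add: o_def)

lemma frechet_derivative_bounded_linear:
  "bounded_linear L \<Longrightarrow> frechet_derivative L (at x) = L"
  by (metis bounded_linear_imp_has_derivative frechet_derivative_at)


section \<open>Smooth bump functions\<close>

text \<open>The powers of \<open>1 / x\<close> make the family closed under differentiation up to
  linear combinations, so one induction over the order, with \<open>n\<close> arbitrary, proves all
  members smooth.\<close>

definition flat_exp :: "nat \<Rightarrow> real \<Rightarrow> real" where
  "flat_exp n x = (if x \<le> 0 then 0 else (1 / x) ^ n * exp (- (1 / x)))"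

lemma flat_exp_tendsto_0: "(flat_exp n \<longlongrightarrow> 0) (at_right 0)"
proof -
  have "((\<lambda>x::real. x ^ n * exp (- x)) \<longlongrightarrow> 0) at_top"
    using tendsto_power_div_exp_0[of n] by (simp add: exp_minus divide_inverse)
  then have "((\<lambda>x::real. inverse x ^ n * exp (- inverse x)) \<longlongrightarrow> 0) (at_right 0)"
    by (rule filterlim_compose[OF _ filterlim_inverse_at_top_right])
  moreover have "eventually (\<lambda>x. inverse x ^ n * exp (- inverse x) = flat_exp n x) (at_right 0)"
    by (auto simp: eventually_at_right_field flat_exp_def divide_inverse intro: exI[of _ 1])
  ultimately show ?thesis by (rule Lim_transform_eventually)
qed

text \<open>The difference quotient at \<open>0\<close> is the next member of the family, whose
  limit is already known.\<close>

lemma flat_exp_has_derivative_0: "(flat_exp n has_real_derivative 0) (at 0)"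
proof -
  have quotient: "(flat_exp n (0 + h) - flat_exp n 0) / h = flat_exp (Suc n) h" for h
    by (auto simp: flat_exp_def divide_inverse)
  have "(flat_exp (Suc n) \<longlongrightarrow> 0) (at_left 0)"
    by (rule Lim_transform_eventually[of "\<lambda>x. 0"]) (auto simp: eventually_at_left_field flat_exp_def intro: exI[of _ "-1"])
  then have "(flat_exp (Suc n) \<longlongrightarrow> 0) (at 0)"
    using flat_exp_tendsto_0 by (auto simp: filterlim_split_at)
  then show ?thesis
    unfolding has_field_derivative_iff using quotient by (simp add: DERIV_def)
qed

lemma flat_exp_has_derivative:
  "(flat_exp n has_real_derivative (flat_exp (n + 2) x - of_nat n * flat_exp (n + 1) x)) (at x)"
proof -
  consider "x < 0" | "x = 0" | "x > 0" by linarith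
  then show ?thesis
  proof cases
    case 1
    have "((\<lambda>x. 0) has_real_derivative 0) (at x)" by simp
    then have "(flat_exp n has_real_derivative 0) (at x)"
      by (rule has_field_derivative_transform_within_open[of _ _ _ "{..<0}"])
         (use 1 in \<open>auto simp: flat_exp_def\<close>)
    with 1 show ?thesis by (simp add: flat_exp_def)
  next
    case 2
    with flat_exp_has_derivative_0 show ?thesis by (simp add: flat_exp_def)
  next
    case 3
    have "((\<lambda>x. (1 / x) ^ n * exp (- (1 / x))) has_real_derivative
        ((1 / x) ^ (n + 2) * exp (- (1 / x)) - of_nat n * ((1 / x) ^ (n + 1) * exp (- (1 / x))))) (at x)"
      using 3
      \<comment> \<open>Differentiating the power gives the exponent \<open>n - 1\<close>, which is
        truncated at \<open>n = 0\<close>; this is why \<open>n\<close> is split.\<close>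
      by (auto intro!: derivative_eq_intros simp: power2_eq_square divide_inverse algebra_simps)
        (cases n; simp add: algebra_simps)
    then have "(flat_exp n has_real_derivative
        ((1 / x) ^ (n + 2) * exp (- (1 / x)) - of_nat n * ((1 / x) ^ (n + 1) * exp (- (1 / x))))) (at x)"
      by (rule has_field_derivative_transform_within_open[of _ _ _ "{0<..}"])
         (use 3 in \<open>auto simp: flat_exp_def\<close>)
    with 3 show ?thesis by (simp add: flat_exp_def)
  qed
qed

lemma smooth_on_flat_exp: "smooth_on (flat_exp n) UNIV"
proof -
  have "Ck_on k (flat_exp n) UNIV" for k
  proof (induction k arbitrary: n)
    case 0
    show ?case
      by (auto intro!: continuous_at_imp_continuous_on DERIV_isCont flat_exp_has_derivative)
  next
    case (Suc k)
    show ?case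
    proof (rule Ck_on_Suc_derivative)
      show "(flat_exp n has_derivative (*) (flat_exp (n + 2) x - of_nat n * flat_exp (n + 1) x)) (at x)" for x
        using flat_exp_has_derivative[of n x] by (simp add: has_field_derivative_def)
      have "Ck_on k (\<lambda>x. flat_exp (n + 2) x + (- of_nat n) * flat_exp (n + 1) x) UNIV"
        by (intro Ck_on_add Ck_on_bounded_linear[OF bounded_linear_mult_right] Suc.IH) auto
      then have "Ck_on k (\<lambda>x. v * (flat_exp (n + 2) x + (- of_nat n) * flat_exp (n + 1) x)) UNIV" for v
        by (intro Ck_on_bounded_linear[OF bounded_linear_mult_right]) auto
      then show "Ck_on k (\<lambda>x. (flat_exp (n + 2) x - of_nat n * flat_exp (n + 1) x) * v) UNIV" for v
        by (simp add: mult.commute)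
    qed simp
  qed
  then show ?thesis by (simp add: smooth_on_def)
qed

text \<open>Asking for a compact \<open>K\<close> inside \<open>S\<close> instead of forming a
  closure makes the property pass to products with the same \<open>K\<close>; it is this
  \<open>K\<close> whose chart preimage is closed in the manifold.\<close>

definition csupp_on :: "('e::euclidean_space \<Rightarrow> 'f::real_normed_vector) \<Rightarrow> 'e set \<Rightarrow> bool" where
  "csupp_on f S \<longleftrightarrow> (\<exists>K. compact K \<and> K \<subseteq> S \<and> (\<forall>x. x \<notin> K \<longrightarrow> f x = 0))"

text \<open>The cutoff is \<open>F (F 1 - F t) / F (F 1)\<close> with the flat function \<open>F = flat_exp 0\<close>: it is \<open>1\<close> for
  \<open>t \<le> 0\<close> and \<open>0\<close> for \<open>t \<ge> 1\<close>, and its smoothness needs no quotient rule.\<close>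

lemma bump_exists:
  fixes S :: "'e::euclidean_space set"
  assumes "open S" "x0 \<in> S"
  obtains \<beta> :: "'e \<Rightarrow> real" and V where "smooth_on \<beta> UNIV" "csupp_on \<beta> S"
    "open V" "x0 \<in> V" "V \<subseteq> S" "\<And>x. x \<in> V \<Longrightarrow> \<beta> x = 1"
proof -
  obtain e where e: "e > 0" "cball x0 e \<subseteq> S"
    using assms open_contains_cball by blast
  define r where "r = e / 2"
  have r: "r > 0" using e by (simp add: r_def)
  define F where "F = flat_exp 0"
  have F: "smooth_on F UNIV" unfolding F_def by (rule smooth_on_flat_exp)
  have F0: "F t = 0" if "t \<le> 0" for t using that by (simp add: F_def flat_exp_def)
  have F1: "F 1 \<le> F t" if "t \<ge> 1" for t using that by (simp add: F_def flat_exp_def)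
  have Fpos: "F t > 0" if "t > 0" for t using that by (simp add: F_def flat_exp_def)
  \<comment> \<open>A rescaled squared distance, hence smooth at \<open>x0\<close> too. It is \<le>
    0 within radius \<open>r\<close> and \<ge> 1 from radius \<open>sqrt 2 * r\<close> on, in
    particular outside radius \<open>e = 2 * r\<close>.\<close>
  define t where "t x = ((x - x0) \<bullet> (x - x0) - r\<^sup>2) / r\<^sup>2" for x
  define \<beta> where "\<beta> x = F (F 1 - F (t x)) / F (F 1)" for x
  have "smooth_on (\<lambda>x. x + (- x0)) UNIV"
    by (intro smooth_on_add smooth_on_id smooth_on_const) auto
  then have "smooth_on (\<lambda>x. (1 / r\<^sup>2) * ((x - x0) \<bullet> (x - x0) + (- r\<^sup>2))) UNIV"
    by (intro smooth_on_bounded_linear[OF bounded_linear_mult_right] smooth_on_add smooth_on_const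
        smooth_on_bilinear[OF bounded_bilinear_inner]) auto
  then have "smooth_on t UNIV"
    by (rule smooth_on_cong[rotated 2]) (auto simp: t_def)
  then have "smooth_on (\<lambda>x. F (t x)) UNIV"
    by (intro smooth_on_compose[OF _ _ _ _ F]) auto
  then have "smooth_on (\<lambda>x. F 1 + (-1) * F (t x)) UNIV"
    by (intro smooth_on_add smooth_on_bounded_linear[OF bounded_linear_mult_right] smooth_on_const) auto
  then have "smooth_on (\<lambda>x. F (F 1 + (-1) * F (t x))) UNIV"
    by (intro smooth_on_compose[OF _ _ _ _ F]) auto
  then have "smooth_on (\<lambda>x. (1 / F (F 1)) * F (F 1 + (-1) * F (t x))) UNIV"
    by (intro smooth_on_bounded_linear[OF bounded_linear_mult_right]) auto
  then have sm: "smooth_on \<beta> UNIV"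
    by (rule smooth_on_cong[rotated 2]) (auto simp: \<beta>_def)
  have norm_t: "t x = ((dist x0 x)\<^sup>2 - r\<^sup>2) / r\<^sup>2" for x
    by (simp add: t_def dist_norm norm_minus_commute[of x0] flip: power2_norm_eq_inner)
  have "\<beta> x = 0" if "x \<notin> cball x0 e" for x
  proof -
    have "2 * r < dist x0 x" using that by (auto simp: r_def)
    then have "(2 * r)\<^sup>2 \<le> (dist x0 x)\<^sup>2" using r by (intro power_mono) auto
    moreover have "(2 * r)\<^sup>2 = 4 * r\<^sup>2" by (simp add: power2_eq_square)
    moreover have "r\<^sup>2 > 0" using r by simp
    ultimately have "r\<^sup>2 \<le> (dist x0 x)\<^sup>2 - r\<^sup>2" by linarith
    then have "t x \<ge> 1" using r by (simp add: norm_t)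
    then show ?thesis using F1 F0 by (simp add: \<beta>_def)
  qed
  then have supp: "csupp_on \<beta> S" unfolding csupp_on_def using e by (intro exI[of _ "cball x0 e"]) auto
  have one: "\<beta> x = 1" if "x \<in> ball x0 r" for x
  proof -
    have "(dist x0 x)\<^sup>2 \<le> r\<^sup>2" using that by (intro power_mono) auto
    then have "t x \<le> 0" by (simp add: norm_t divide_nonpos_nonneg)
    moreover have "F (F 1) > 0" using Fpos by simp
    ultimately show ?thesis using F0 by (simp add: \<beta>_def)
  qed
  have "ball x0 r \<subseteq> S" using e r by (auto simp: r_def subset_iff)
  with sm supp one r show thesis by (intro that[of \<beta> "ball x0 r"]) auto
qed

lemma csupp_on_scaleR: "csupp_on f S \<Longrightarrow> csupp_on (\<lambda>x. f x *\<^sub>R h x) S"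
  unfolding csupp_on_def by (metis scaleR_zero_left)

lemma csupp_on_mult: "csupp_on (f :: _ \<Rightarrow> real) S \<Longrightarrow> csupp_on (\<lambda>x. f x * h x) S"
  unfolding csupp_on_def by (metis mult_zero_left)

section \<open>Atlases and tangent spaces\<close>

abbreviation cdom :: "('a, 'e) chart \<Rightarrow> 'e set" where
  "cdom c \<equiv> snd c ` fst c"

definition trans_deriv :: "('a, 'e::euclidean_space) chart \<Rightarrow> ('a, 'e) chart \<Rightarrow> 'a \<Rightarrow> 'e \<Rightarrow> 'e" where
  "trans_deriv c d p = frechet_derivative (snd d \<circ> chart_inv c) (at (snd c p))"

text \<open>The inverse of evaluation at \<open>c\<close> (\<open>tvec_of_apply\<close>,
  \<open>tvec_of_tangent\<close>): a tangent vector is prescribed by a single coordinate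
  value.\<close>

definition tvec_of :: "('a, 'e::euclidean_space) manifold \<Rightarrow> ('a, 'e) chart \<Rightarrow> 'a \<Rightarrow> 'e \<Rightarrow> ('a, 'e) tvec" where
  "tvec_of M c p y = (\<lambda>d. if d \<in> atlas M \<and> p \<in> fst d then trans_deriv c d p y else 0)"

lemma chart_inv_in: "x \<in> cdom c \<Longrightarrow> chart_inv c x \<in> fst c"
  by (simp add: chart_inv_def inv_into_into)

lemma chart_chart_inv: "x \<in> cdom c \<Longrightarrow> snd c (chart_inv c x) = x"
  by (simp add: chart_inv_def f_inv_into_f)

text \<open>The part of the manifold axioms that does not mention the topology. Unlike the full axioms, it
  is easily seen to be inherited by the tangent bundle.\<close>

locale smooth_atlas =
  fixes M :: "('a, 'e::euclidean_space) manifold"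
  assumes points_eq: "points M = (\<Union>c\<in>atlas M. fst c)"
    and inj_chart: "c \<in> atlas M \<Longrightarrow> inj_on (snd c) (fst c)"
    and open_overlap: "c \<in> atlas M \<Longrightarrow> d \<in> atlas M \<Longrightarrow> open (snd c ` (fst c \<inter> fst d))"
    and smooth_transition: "c \<in> atlas M \<Longrightarrow> d \<in> atlas M \<Longrightarrow>
      smooth_on (snd d \<circ> chart_inv c) (snd c ` (fst c \<inter> fst d))"
begin

lemma chart_inv_chart: "c \<in> atlas M \<Longrightarrow> p \<in> fst c \<Longrightarrow> chart_inv c (snd c p) = p"
  by (simp add: chart_inv_def inj_chart)

lemma open_cdom: "c \<in> atlas M \<Longrightarrow> open (cdom c)"
  using open_overlap[of c c] by simp

lemma chart_in_points: "c \<in> atlas M \<Longrightarrow> p \<in> fst c \<Longrightarrow> p \<in> points M"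
  using points_eq by auto

lemma point_in_chart:
  assumes "p \<in> points M"
  obtains c where "c \<in> atlas M" "p \<in> fst c"
  using assms points_eq by auto

lemma transition_differentiable:
  assumes "c \<in> atlas M" "d \<in> atlas M" "p \<in> fst c" "p \<in> fst d"
  shows "(snd d \<circ> chart_inv c) differentiable (at (snd c p))"
  using smooth_on_imp_differentiable[OF smooth_transition[OF assms(1,2)]] assms by blast

text \<open>The chain rule through the transition map. With values in any normed space it serves
  real functions, further charts, and maps followed by a chart of the target.\<close>

lemma deriv_change_chart:
  fixes h :: "'a \<Rightarrow> 'b::real_normed_vector"
  assumes cd: "c \<in> atlas M" "d \<in> atlas M" "p \<in> fst c" "p \<in> fst d"
    and h: "(h \<circ> chart_inv d) differentiable (at (snd d p))"
  shows "(h \<circ> chart_inv c) differentiable (at (snd c p))"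
    and "frechet_derivative (h \<circ> chart_inv c) (at (snd c p)) v =
      frechet_derivative (h \<circ> chart_inv d) (at (snd d p)) (trans_deriv c d p v)"
proof -
  let ?t = "snd d \<circ> chart_inv c" and ?S = "snd c ` (fst c \<inter> fst d)"
  have t: "?t (snd c p) = snd d p" using cd by (simp add: chart_inv_chart)
  have eq: "(h \<circ> chart_inv c) y = (h \<circ> chart_inv d) (?t y)" if "y \<in> ?S" for y
    using that cd by (auto simp: chart_inv_chart)
  have mem: "snd c p \<in> ?S" using cd by simp
  have dt: "?t differentiable (at (snd c p))" by (rule transition_differentiable[OF cd])
  have dh: "(h \<circ> chart_inv d) differentiable (at (?t (snd c p)))" using h t by simp
  have "((\<lambda>y. (h \<circ> chart_inv d) (?t y)) has_derivative
      frechet_derivative (h \<circ> chart_inv d) (at (snd d p)) \<circ> trans_deriv c d p) (at (snd c p))"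
    using diff_chain_at[of ?t _ "snd c p" "h \<circ> chart_inv d"] dt dh t
    by (simp add: frechet_derivative_works trans_deriv_def o_def)
  then have D: "((h \<circ> chart_inv c) has_derivative
      frechet_derivative (h \<circ> chart_inv d) (at (snd d p)) \<circ> trans_deriv c d p) (at (snd c p))"
    by (rule has_derivative_transform_within_open[OF _ open_overlap[OF cd(1,2)] mem]) (rule eq[symmetric])
  show "(h \<circ> chart_inv c) differentiable (at (snd c p))"
    using D by (rule differentiableI)
  show "frechet_derivative (h \<circ> chart_inv c) (at (snd c p)) v =
      frechet_derivative (h \<circ> chart_inv d) (at (snd d p)) (trans_deriv c d p v)"
    using frechet_derivative_at[OF D] by (metis comp_apply)
qed

lemma smooth_change_chart:
  fixes h :: "'a \<Rightarrow> 'b::real_normed_vector"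
  assumes cd: "c \<in> atlas M" "d \<in> atlas M" and T: "T \<subseteq> fst c \<inter> fst d" "open (snd c ` T)" "open (snd d ` T)"
    and h: "smooth_on (h \<circ> chart_inv d) (snd d ` T)"
  shows "smooth_on (h \<circ> chart_inv c) (snd c ` T)"
proof -
  have "smooth_on (\<lambda>x. (h \<circ> chart_inv d) ((snd d \<circ> chart_inv c) x)) (snd c ` T)"
  proof (rule smooth_on_compose[OF T(2,3) _ _ h])
    show "(snd d \<circ> chart_inv c) ` snd c ` T \<subseteq> snd d ` T"
      using T(1) cd by (auto simp: chart_inv_chart subset_iff)
    show "smooth_on (snd d \<circ> chart_inv c) (snd c ` T)"
      using smooth_transition[OF cd] T(1) by (auto intro: smooth_on_subset)
  qed
  then show ?thesis
  proof (rule smooth_on_cong[OF T(2), rotated])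
    fix x assume "x \<in> snd c ` T"
    then obtain p where "p \<in> fst c" "p \<in> fst d" "x = snd c p" using T(1) by auto
    then show "(h \<circ> chart_inv d) ((snd d \<circ> chart_inv c) x) = (h \<circ> chart_inv c) x"
      using cd by (simp add: chart_inv_chart)
  qed
qed

lemma linear_trans_deriv:
  "c \<in> atlas M \<Longrightarrow> d \<in> atlas M \<Longrightarrow> p \<in> fst c \<Longrightarrow> p \<in> fst d \<Longrightarrow> linear (trans_deriv c d p)"
  unfolding trans_deriv_def by (intro linear_frechet_derivative transition_differentiable)

lemma trans_deriv_self:
  assumes "c \<in> atlas M" "p \<in> fst c"
  shows "trans_deriv c c p y = y"
proof -
  have "frechet_derivative (snd c \<circ> chart_inv c) (at (snd c p)) = frechet_derivative (\<lambda>x. x) (at (snd c p))"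
    by (rule frechet_derivative_cong[OF open_cdom[OF assms(1)]]) (use assms in \<open>auto simp: chart_inv_chart\<close>)
  then show ?thesis by (simp add: trans_deriv_def)
qed

text \<open>The cocycle identity, obtained from \<open>deriv_change_chart\<close> with the third
  chart as \<open>h\<close>. It is what makes \<open>tvec_of\<close> compatible between
  charts.\<close>

lemma trans_deriv_trans:
  assumes "c \<in> atlas M" "d \<in> atlas M" "e \<in> atlas M" "p \<in> fst c" "p \<in> fst d" "p \<in> fst e"
  shows "trans_deriv d e p (trans_deriv c d p y) = trans_deriv c e p y"
  using deriv_change_chart(2)[OF assms(1,2,4,5) transition_differentiable[OF assms(2,3,5,6)]]
  by (simp add: trans_deriv_def)

lemma tangent_space_iff:
  "v \<in> tangent_space M p \<longleftrightarrow>
     (\<forall>c. \<not> (c \<in> atlas M \<and> p \<in> fst c) \<longrightarrow> v c = 0) \<and>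
     (\<forall>c\<in>atlas M. \<forall>d\<in>atlas M. p \<in> fst c \<longrightarrow> p \<in> fst d \<longrightarrow> v d = trans_deriv c d p (v c))"
  by (simp add: tangent_space_def trans_deriv_def)

lemma tangent_spaceI:
  assumes "\<And>c. \<not> (c \<in> atlas M \<and> p \<in> fst c) \<Longrightarrow> v c = 0"
    and "\<And>c d. c \<in> atlas M \<Longrightarrow> d \<in> atlas M \<Longrightarrow> p \<in> fst c \<Longrightarrow> p \<in> fst d \<Longrightarrow> v d = trans_deriv c d p (v c)"
  shows "v \<in> tangent_space M p"
  using assms unfolding tangent_space_iff by blast

lemma tangent_vector_outside:
  assumes "v \<in> tangent_space M p" "\<not> (c \<in> atlas M \<and> p \<in> fst c)"
  shows "v c = 0"
  using assms unfolding tangent_space_iff by blast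

lemma tangent_vector_transform:
  "v \<in> tangent_space M p \<Longrightarrow> c \<in> atlas M \<Longrightarrow> d \<in> atlas M \<Longrightarrow> p \<in> fst c \<Longrightarrow> p \<in> fst d \<Longrightarrow>
    v d = trans_deriv c d p (v c)"
  unfolding tangent_space_iff by blast

text \<open>One chart decides: the transition derivatives give the coordinates in the other charts
  around \<open>p\<close>, and elsewhere both families are \<open>0\<close>.\<close>

lemma tangent_vector_eqI:
  assumes "v \<in> tangent_space M p" "w \<in> tangent_space M p" "c \<in> atlas M" "p \<in> fst c" "v c = w c"
  shows "v = w"
proof
  fix d
  show "v d = w d"
  proof (cases "d \<in> atlas M \<and> p \<in> fst d")
    case True
    then show ?thesis using assms tangent_vector_transform[of _ p c d] by metis
  next
    case False
    then show ?thesis using assms(1,2) tangent_vector_outside by metis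
  qed
qed

lemma tvec_of_in:
  assumes "c \<in> atlas M" "p \<in> fst c"
  shows "tvec_of M c p y \<in> tangent_space M p"
  by (rule tangent_spaceI) (use assms in \<open>auto simp: tvec_of_def trans_deriv_trans\<close>)

lemma tvec_of_apply: "c \<in> atlas M \<Longrightarrow> p \<in> fst c \<Longrightarrow> tvec_of M c p y c = y"
  by (simp add: tvec_of_def trans_deriv_self)

lemma tvec_of_tangent:
  assumes "c \<in> atlas M" "p \<in> fst c" "v \<in> tangent_space M p"
  shows "tvec_of M c p (v c) = v"
  by (rule tangent_vector_eqI[OF tvec_of_in[OF assms(1,2)] assms(3,1,2)]) (simp add: tvec_of_apply assms)

lemma tzero_in: "tzero \<in> tangent_space M p"
  by (rule tangent_spaceI) (simp_all add: tzero_def linear_0[OF linear_trans_deriv])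

lemma lincomb_in:
  assumes "v \<in> tangent_space M p" "w \<in> tangent_space M p"
  shows "lincomb a v b w \<in> tangent_space M p"
proof (rule tangent_spaceI)
  show "lincomb a v b w c = 0" if "\<not> (c \<in> atlas M \<and> p \<in> fst c)" for c
    using tangent_vector_outside[OF assms(1) that] tangent_vector_outside[OF assms(2) that]
    by (simp add: lincomb_def)
  show "lincomb a v b w d = trans_deriv c d p (lincomb a v b w c)"
    if cd: "c \<in> atlas M" "d \<in> atlas M" "p \<in> fst c" "p \<in> fst d" for c d
    using linear_trans_deriv[OF cd] tangent_vector_transform[OF assms(1) cd] tangent_vector_transform[OF assms(2) cd]
    by (simp add: lincomb_def linear_add linear_cmul)
qed

lemma tvec_of_lincomb:
  assumes "c \<in> atlas M" "p \<in> fst c"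
  shows "tvec_of M c p (a *\<^sub>R y + b *\<^sub>R z) = lincomb a (tvec_of M c p y) b (tvec_of M c p z)"
  by (rule tangent_vector_eqI[OF tvec_of_in[OF assms] lincomb_in[OF tvec_of_in[OF assms] tvec_of_in[OF assms]] assms])
     (simp add: tvec_of_apply lincomb_def assms)

lemma tvec_of_0: "c \<in> atlas M \<Longrightarrow> p \<in> fst c \<Longrightarrow> tvec_of M c p 0 = tzero"
  using tvec_of_tangent[OF _ _ tzero_in] by (simp add: tzero_def)

text \<open>Gives the definite description a value: by \<open>deriv_change_chart\<close> the
  candidates from all charts around \<open>p\<close> coincide.\<close>

lemma dir_deriv_eq:
  assumes f: "smooth_fun M f" and v: "v \<in> tangent_space M p" and c: "c \<in> atlas M" "p \<in> fst c"
  shows "dir_deriv M f p v = frechet_derivative (f \<circ> chart_inv c) (at (snd c p)) (v c)"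
  unfolding dir_deriv_def
proof (rule the_equality)
  have "frechet_derivative (f \<circ> chart_inv c) (at (snd c p)) (v c) =
      frechet_derivative (f \<circ> chart_inv d) (at (snd d p)) (v d)" if d: "d \<in> atlas M" "p \<in> fst d" for d
  proof -
    have "(f \<circ> chart_inv d) differentiable (at (snd d p))"
      using f d by (auto simp: smooth_fun_def intro: smooth_on_imp_differentiable)
    from deriv_change_chart(2)[OF c(1) d(1) c(2) d(2) this, of "v c"] show ?thesis
      by (simp add: tangent_vector_transform[OF v c(1) d(1) c(2) d(2)])
  qed
  then show "\<forall>d\<in>atlas M. p \<in> fst d \<longrightarrow> frechet_derivative (f \<circ> chart_inv c) (at (snd c p)) (v c) =
      frechet_derivative (f \<circ> chart_inv d) (at (snd d p)) (v d)" by blast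
qed (use c in blast)

end

text \<open>Openness of the chart overlaps stands for the continuity of \<open>F\<close>. For
  sections and for the projection it is read off the atlas, without going through the generated
  topology of the bundle.\<close>

lemma differential_eq:
  fixes M :: "('a, 'e::euclidean_space) manifold" and N :: "('b, 'f::euclidean_space) manifold"
  assumes "smooth_atlas M" "smooth_atlas N"
    and F: "\<And>c d. c \<in> atlas M \<Longrightarrow> d \<in> atlas N \<Longrightarrow> open (snd c ` (fst c \<inter> F -` fst d))"
      "\<And>c d. c \<in> atlas M \<Longrightarrow> d \<in> atlas N \<Longrightarrow>
        smooth_on (snd d \<circ> F \<circ> chart_inv c) (snd c ` (fst c \<inter> F -` fst d))"
    and p: "p \<in> points M" "F p \<in> points N" and v: "v \<in> tangent_space M p"
  shows "differential M N F p v \<in> tangent_space N (F p)"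
    and "c \<in> atlas M \<Longrightarrow> d \<in> atlas N \<Longrightarrow> p \<in> fst c \<Longrightarrow> F p \<in> fst d \<Longrightarrow>
      differential M N F p v d = frechet_derivative (snd d \<circ> F \<circ> chart_inv c) (at (snd c p)) (v c)"
proof -
  interpret M: smooth_atlas M by fact
  interpret N: smooth_atlas N by fact
  obtain c0 where c0: "c0 \<in> atlas M" "p \<in> fst c0" using p M.point_in_chart by blast
  obtain d0 where d0: "d0 \<in> atlas N" "F p \<in> fst d0" using p N.point_in_chart by blast
  let ?D = "\<lambda>c d. frechet_derivative (snd d \<circ> F \<circ> chart_inv c) (at (snd c p))"
  let ?P = "\<lambda>w. w \<in> tangent_space N (F p) \<and> (\<forall>c\<in>atlas M. \<forall>d\<in>atlas N. p \<in> fst c \<longrightarrow> F p \<in> fst d \<longrightarrow>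
    w d = ?D c d (v c))"
  let ?w = "tvec_of N d0 (F p) (?D c0 d0 (v c0))"
  have diff: "(snd d \<circ> F \<circ> chart_inv c) differentiable (at (snd c p))"
    if "c \<in> atlas M" "p \<in> fst c" "d \<in> atlas N" "F p \<in> fst d" for c d
    using smooth_on_imp_differentiable[OF F(2)[OF that(1,3)]] that by blast
  \<comment> \<open>Compatibility over all pairs of charts is reduced to the pair \<open>c0\<close>,
    \<open>d0\<close> by changing the target chart and then the source chart.\<close>
  have D0: "?D c d (v c) = trans_deriv d0 d (F p) (?D c0 d0 (v c0))"
    if c: "c \<in> atlas M" "p \<in> fst c" and d: "d \<in> atlas N" "F p \<in> fst d" for c d
  proof -
    let ?f = "snd d0 \<circ> F \<circ> chart_inv c0" and ?t = "snd d \<circ> chart_inv d0"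
    have f: "?f (snd c0 p) = snd d0 (F p)" using c0 by (simp add: M.chart_inv_chart)
    have "?D c0 d (v c0) = frechet_derivative (\<lambda>x. ?t (?f x)) (at (snd c0 p)) (v c0)"
      by (subst frechet_derivative_cong[OF F(1)[OF c0(1) d0(1)], of _ _ "\<lambda>x. ?t (?f x)"])
         (use c0 d0 in \<open>auto simp: M.chart_inv_chart N.chart_inv_chart\<close>)
    also have "\<dots> = frechet_derivative ?t (at (?f (snd c0 p))) (?D c0 d0 (v c0))"
      using N.transition_differentiable[OF d0(1) d(1) d0(2) d(2)] diff[OF c0 d0]
      by (intro frechet_derivative_chain) (simp_all only: f)
    finally have "?D c0 d (v c0) = trans_deriv d0 d (F p) (?D c0 d0 (v c0))"
      by (simp only: f trans_deriv_def)
    moreover have "?D c d (v c) = ?D c0 d (v c0)"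
      using M.deriv_change_chart(2)[OF c0(1) c(1) c0(2) c(2), of "snd d \<circ> F" "v c0"] diff[OF c d]
        M.tangent_vector_transform[OF v c0(1) c(1) c0(2) c(2)] by (simp add: o_assoc)
    ultimately show ?thesis by simp
  qed
  have "?P ?w"
    using N.tvec_of_in[OF d0] D0 by (auto simp: tvec_of_def)
  moreover have "w = ?w" if "?P w" for w
    by (rule N.tangent_vector_eqI[OF _ N.tvec_of_in[OF d0] d0])
       (use that c0 d0 in \<open>auto simp: N.tvec_of_apply\<close>)
  ultimately have "?P (differential M N F p v)"
    unfolding differential_def by (rule theI)
  then show "differential M N F p v \<in> tangent_space N (F p)"
    and "c \<in> atlas M \<Longrightarrow> d \<in> atlas N \<Longrightarrow> p \<in> fst c \<Longrightarrow> F p \<in> fst d \<Longrightarrow>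
      differential M N F p v d = ?D c d (v c)" by blast+
qed


section \<open>The tangent bundle\<close>

lemma fst_tb_chart [simp]: "fst (tb_chart M c) = Sigma (fst c) (tangent_space M)"
  by (simp add: tb_chart_def)

lemma snd_tb_chart [simp]: "snd (tb_chart M c) (p, u) = (snd c p, u c)"
  by (simp add: tb_chart_def)

lemma snd_tb_chart': "snd (tb_chart M c) w = (snd c (fst w), snd w c)"
  by (cases w) simp

lemma atlas_tangent_bundle [simp]: "atlas (tangent_bundle M) = tb_chart M ` atlas M"
  by (simp add: tangent_bundle_def)

context smooth_atlas
begin

lemma points_tangent_bundle: "points (tangent_bundle M) = Sigma (points M) (tangent_space M)"
proof -
  have "points (tangent_bundle M) = (\<Union>c\<in>atlas M. fst (tb_chart M c))"
    \<comment> \<open>The generator with \<open>W = UNIV\<close> is the whole domain of the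
      chart.\<close>
    by (auto simp: tangent_bundle_def simp del: fst_tb_chart) (use open_UNIV in blast)
  then show ?thesis by (auto simp: points_eq)
qed

lemma tb_image:
  assumes c: "c \<in> atlas M" and T: "T \<subseteq> fst c"
  shows "snd (tb_chart M c) ` Sigma T (tangent_space M) = (snd c ` T) \<times> UNIV"
proof (intro subset_antisym subsetI)
  fix z assume "z \<in> (snd c ` T) \<times> (UNIV :: 'e set)"
  then obtain p where p: "p \<in> T" "fst z = snd c p" by auto
  have "z = snd (tb_chart M c) (p, tvec_of M c p (snd z))"
    using c T p by (auto simp: tvec_of_apply prod_eq_iff)
  then show "z \<in> snd (tb_chart M c) ` Sigma T (tangent_space M)"
    using p T c by (auto intro!: image_eqI[where x = "(p, tvec_of M c p (snd z))"] tvec_of_in)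
qed auto

lemma cdom_tb_chart: "c \<in> atlas M \<Longrightarrow> cdom (tb_chart M c) = cdom c \<times> UNIV"
  by (simp add: tb_image)

lemma inj_tb_chart:
  assumes c: "c \<in> atlas M"
  shows "inj_on (snd (tb_chart M c)) (fst (tb_chart M c))"
proof (rule inj_onI)
  fix w z assume w: "w \<in> fst (tb_chart M c)" "z \<in> fst (tb_chart M c)"
    and "snd (tb_chart M c) w = snd (tb_chart M c) z"
  then have eq: "snd c (fst w) = snd c (fst z)" "snd w c = snd z c" by (auto simp: snd_tb_chart')
  have "fst w = fst z" using eq(1) w c by (auto dest: inj_onD[OF inj_chart])
  moreover have "snd w = snd z"
    by (rule tangent_vector_eqI[where p = "fst z" and c = c]) (use w eq c calculation in auto)
  ultimately show "w = z" by (simp add: prod_eq_iff)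
qed

lemma chart_inv_tb:
  assumes c: "c \<in> atlas M" and x: "x \<in> cdom c"
  shows "chart_inv (tb_chart M c) (x, y) = (chart_inv c x, tvec_of M c (chart_inv c x) y)"
proof -
  let ?w = "(chart_inv c x, tvec_of M c (chart_inv c x) y)"
  have "?w \<in> fst (tb_chart M c)"
    using chart_inv_in[OF x] c by (simp add: tvec_of_in)
  moreover have "snd (tb_chart M c) ?w = (x, y)"
    using chart_inv_in[OF x] c x by (simp add: chart_chart_inv tvec_of_apply)
  ultimately show ?thesis
    unfolding chart_inv_def by (metis inj_tb_chart[OF c] inv_into_f_f)
qed

lemma tb_transition:
  assumes c: "c \<in> atlas M" and d: "d \<in> atlas M" and x: "x \<in> snd c ` (fst c \<inter> fst d)"
  shows "(snd (tb_chart M d) \<circ> chart_inv (tb_chart M c)) (x, y) =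
    ((snd d \<circ> chart_inv c) x, frechet_derivative (snd d \<circ> chart_inv c) (at x) y)"
proof -
  have "x \<in> cdom c" "chart_inv c x \<in> fst d" using x c by (auto simp: chart_inv_chart)
  then show ?thesis
    using c d by (simp add: chart_inv_tb tvec_of_def trans_deriv_def chart_chart_inv)
qed

text \<open>Makes everything proved so far for an atlas available for the bundle, in particular for
  the tangent vectors \<xi> of \<open>TM\<close>.\<close>

lemma smooth_atlas_tangent_bundle: "smooth_atlas (tangent_bundle M)"
proof
  show "points (tangent_bundle M) = (\<Union>c\<in>atlas (tangent_bundle M). fst c)"
    by (auto simp: points_tangent_bundle points_eq)
next
  fix C assume "C \<in> atlas (tangent_bundle M)"
  then show "inj_on (snd C) (fst C)" by (auto intro: inj_tb_chart simp del: fst_tb_chart)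
next
  fix C D assume "C \<in> atlas (tangent_bundle M)" "D \<in> atlas (tangent_bundle M)"
  then obtain c d where C: "C = tb_chart M c" "c \<in> atlas M" and D: "D = tb_chart M d" "d \<in> atlas M"
    by auto
  let ?S = "snd c ` (fst c \<inter> fst d)"
  have "fst C \<inter> fst D = Sigma (fst c \<inter> fst d) (tangent_space M)" by (auto simp: C D)
  then have im: "snd C ` (fst C \<inter> fst D) = ?S \<times> UNIV" using tb_image[OF C(2)] C by simp
  have o: "open ?S" by (rule open_overlap[OF C(2) D(2)])
  then show op: "open (snd C ` (fst C \<inter> fst D))" unfolding im by (intro open_Times open_UNIV)
  have o': "open (?S \<times> (UNIV :: 'e set))" using o by (intro open_Times open_UNIV)
  have f: "smooth_on (\<lambda>z::'e \<times> 'e. fst z) (?S \<times> UNIV)" "smooth_on (\<lambda>z::'e \<times> 'e. snd z) (?S \<times> UNIV)"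
    by (rule smooth_on_bounded_linear[OF _ o' smooth_on_id[OF o']];
        simp add: bounded_linear_fst bounded_linear_snd)+
  have t: "smooth_on (\<lambda>z. (snd d \<circ> chart_inv c) (fst z)) (?S \<times> (UNIV :: 'e set))"
    by (rule smooth_on_compose[OF o' o _ f(1) smooth_transition[OF C(2) D(2)]]) auto
  have D1: "smooth_on (\<lambda>z. frechet_derivative (snd d \<circ> chart_inv c) (at (fst z)) i) (?S \<times> (UNIV :: 'e set))" for i
    by (rule smooth_on_compose[OF o' o _ f(1) smooth_on_frechet_derivative[OF smooth_transition[OF C(2) D(2)]]]) auto
  \<comment> \<open>By \<open>tb_transition\<close> this is the transition map of the bundle. Its
    second component is linear in the fibre coordinate and, for a fixed vector, smooth in the base
    point.\<close>
  have "smooth_on (\<lambda>z. ((snd d \<circ> chart_inv c) (fst z),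
      frechet_derivative (snd d \<circ> chart_inv c) (at (fst z)) (snd z))) (?S \<times> UNIV)"
  proof (rule smooth_on_Pair[OF o' t smooth_on_linear_family[OF o' _ D1 f(2)]])
    show "linear (frechet_derivative (snd d \<circ> chart_inv c) (at (fst z)))" if "z \<in> ?S \<times> (UNIV :: 'e set)" for z
      using that smooth_on_imp_differentiable[OF smooth_transition[OF C(2) D(2)]]
      by (intro linear_frechet_derivative) auto
  qed
  then show "smooth_on (snd D \<circ> chart_inv C) (snd C ` (fst C \<inter> fst D))"
    unfolding im by (rule smooth_on_cong[OF o', rotated]) (use C D in \<open>auto simp: tb_transition simp del: comp_apply\<close>)
qed

end

section \<open>Vector fields in coordinates; differentials of sections and of the projection\<close>

definition coord :: "('a, 'e) chart \<Rightarrow> ('a \<Rightarrow> ('a, 'e) tvec) \<Rightarrow> 'e \<Rightarrow> 'e" where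
  "coord c X x = X (chart_inv c x) c"

text \<open>Replaces \<open>vector_field\<close> by a condition on the fibre coordinate, with one
  chart for base and fibre. The passage from \<open>vector_field\<close> to it works over any
  \<open>smooth_atlas\<close>, hence also for fields on \<open>TM\<close>.\<close>

definition smooth_field :: "('a, 'e::euclidean_space) manifold \<Rightarrow> ('a \<Rightarrow> ('a, 'e) tvec) \<Rightarrow> bool" where
  "smooth_field M X \<longleftrightarrow>
     (\<forall>p\<in>points M. X p \<in> tangent_space M p) \<and> (\<forall>c\<in>atlas M. smooth_on (coord c X) (cdom c))"

context smooth_atlas
begin

lemma smooth_field_tangent: "smooth_field M X \<Longrightarrow> p \<in> points M \<Longrightarrow> X p \<in> tangent_space M p"
  by (simp add: smooth_field_def)

lemma smooth_field_coord: "smooth_field M X \<Longrightarrow> c \<in> atlas M \<Longrightarrow> smooth_on (coord c X) (cdom c)"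
  by (simp add: smooth_field_def)

lemma section_domain:
  assumes X: "\<forall>p\<in>points M. X p \<in> tangent_space M p" and c: "c \<in> atlas M"
  shows "fst c \<inter> tb_section X -` fst (tb_chart M d) = fst c \<inter> fst d"
  using X chart_in_points[OF c] by (auto simp: tb_section_def)

lemma vector_field_imp_smooth_field:
  assumes "vector_field M X"
  shows "smooth_field M X"
  unfolding smooth_field_def
proof (intro conjI ballI)
  have X: "\<forall>p\<in>points M. X p \<in> tangent_space M p"
    using assms by (simp add: vector_field_def)
  then show "X p \<in> tangent_space M p" if "p \<in> points M" for p
    using that by blast
  fix c assume c: "c \<in> atlas M"
  have "fst c \<inter> tb_section X -` fst (tb_chart M c) = fst c"
    using section_domain[OF X c] by blast
  moreover have "smooth_on (snd (tb_chart M c) \<circ> tb_section X \<circ> chart_inv c)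
      (snd c ` (fst c \<inter> tb_section X -` fst (tb_chart M c)))"
    using assms c by (simp add: vector_field_def smooth_map_def del: fst_tb_chart)
  ultimately have "smooth_on (snd (tb_chart M c) \<circ> tb_section X \<circ> chart_inv c) (cdom c)"
    by metis
  from smooth_on_bounded_linear[OF bounded_linear_snd open_cdom[OF c] this]
  show "smooth_on (coord c X) (cdom c)"
    by (rule smooth_on_cong[OF open_cdom[OF c], rotated]) (simp add: tb_section_def coord_def)
qed

lemma smooth_section:
  assumes X: "smooth_field M X" and c: "c \<in> atlas M" and d: "d \<in> atlas M"
  shows "smooth_on (snd (tb_chart M d) \<circ> tb_section X \<circ> chart_inv c) (snd c ` (fst c \<inter> fst d))"
proof -
  let ?S = "snd c ` (fst c \<inter> fst d)"
  have "smooth_on ((\<lambda>q. X q d) \<circ> chart_inv d) (snd d ` (fst c \<inter> fst d))"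
    by (rule smooth_on_subset[where S = "cdom d"])
       (use smooth_field_coord[OF X d] in \<open>auto simp: coord_def[abs_def] o_def\<close>)
  then have "smooth_on ((\<lambda>q. X q d) \<circ> chart_inv c) ?S"
    by (intro smooth_change_chart[OF c d] open_overlap c d)
       (use open_overlap[OF d c] in \<open>auto simp: Int_commute\<close>)
  from smooth_on_Pair[OF open_overlap[OF c d] smooth_transition[OF c d] this]
  show ?thesis
    by (rule smooth_on_cong[OF open_overlap[OF c d], rotated]) (simp add: tb_section_def)
qed

text \<open>In coordinates the section is the graph map
  \<open>x \<mapsto> (x, coord c Z x)\<close>.\<close>

lemma differential_section:
  assumes Z: "smooth_field M Z" and p: "p \<in> points M" and v: "v \<in> tangent_space M p"
  shows "differential M (tangent_bundle M) (tb_section Z) p v \<in> tangent_space (tangent_bundle M) (p, Z p)"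
    and "c \<in> atlas M \<Longrightarrow> p \<in> fst c \<Longrightarrow>
      differential M (tangent_bundle M) (tb_section Z) p v (tb_chart M c) =
        (v c, frechet_derivative (coord c Z) (at (snd c p)) (v c))"
proof -
  have Zt: "\<forall>p\<in>points M. Z p \<in> tangent_space M p" using Z by (simp add: smooth_field_def)
  have op: "open (snd c ` (fst c \<inter> tb_section Z -` fst D))"
    and sm: "smooth_on (snd D \<circ> tb_section Z \<circ> chart_inv c) (snd c ` (fst c \<inter> tb_section Z -` fst D))"
    if c: "c \<in> atlas M" and D: "D \<in> atlas (tangent_bundle M)" for c D
  proof -
    obtain d where d: "D = tb_chart M d" "d \<in> atlas M" using D by auto
    show "open (snd c ` (fst c \<inter> tb_section Z -` fst D))"
      unfolding d section_domain[OF Zt c] by (rule open_overlap[OF c d(2)])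
    show "smooth_on (snd D \<circ> tb_section Z \<circ> chart_inv c) (snd c ` (fst c \<inter> tb_section Z -` fst D))"
      unfolding d section_domain[OF Zt c] by (rule smooth_section[OF Z c d(2)])
  qed
  have p': "tb_section Z p \<in> points (tangent_bundle M)"
    using p Zt by (simp add: points_tangent_bundle tb_section_def)
  note D = differential_eq[OF smooth_atlas_axioms smooth_atlas_tangent_bundle op sm p p' v]
  show "differential M (tangent_bundle M) (tb_section Z) p v \<in> tangent_space (tangent_bundle M) (p, Z p)"
    using D(1) by (simp add: tb_section_def[of Z p])
  assume c: "c \<in> atlas M" "p \<in> fst c"
  have x: "snd c p \<in> cdom c" using c by simp
  have "tb_section Z p \<in> fst (tb_chart M c)" using c p Zt by (simp add: tb_section_def)
  then have "differential M (tangent_bundle M) (tb_section Z) p v (tb_chart M c) =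
      frechet_derivative (snd (tb_chart M c) \<circ> tb_section Z \<circ> chart_inv c) (at (snd c p)) (v c)"
    using D(2)[of c "tb_chart M c"] c by simp
  also have "frechet_derivative (snd (tb_chart M c) \<circ> tb_section Z \<circ> chart_inv c) (at (snd c p)) =
      frechet_derivative (\<lambda>x. (x, coord c Z x)) (at (snd c p))"
    by (rule frechet_derivative_cong[OF open_cdom[OF c(1)] x])
       (simp add: tb_section_def coord_def chart_chart_inv)
  also have "\<dots> = (\<lambda>v. (v, frechet_derivative (coord c Z) (at (snd c p)) v))"
    by (rule frechet_derivative_at[symmetric] has_derivative_Pair has_derivative_ident
        smooth_on_imp_has_derivative[OF smooth_field_coord[OF Z c(1)] x])+
  finally show "differential M (tangent_bundle M) (tb_section Z) p v (tb_chart M c) =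
        (v c, frechet_derivative (coord c Z) (at (snd c p)) (v c))" .
qed

text \<open>In coordinates the projection is \<open>fst\<close>, which is its own
  derivative.\<close>

lemma dproj_eq:
  assumes w: "w \<in> points (tangent_bundle M)" and \<xi>: "\<xi> \<in> tangent_space (tangent_bundle M) w"
  shows "dproj M w \<xi> \<in> tangent_space M (fst w)"
    and "c \<in> atlas M \<Longrightarrow> fst w \<in> fst c \<Longrightarrow> dproj M w \<xi> c = fst (\<xi> (tb_chart M c))"
proof -
  have fst_conv: "(snd d \<circ> fst \<circ> chart_inv (tb_chart M c)) z = (snd d \<circ> chart_inv c) (fst z)"
    if "c \<in> atlas M" "fst z \<in> cdom c" for c d z
    using that by (cases z) (simp add: chart_inv_tb)
  have im: "snd (tb_chart M c) ` (fst (tb_chart M c) \<inter> fst -` fst d) = snd c ` (fst c \<inter> fst d) \<times> UNIV"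
    if "c \<in> atlas M" for c d
  proof -
    have "fst (tb_chart M c) \<inter> fst -` fst d = Sigma (fst c \<inter> fst d) (tangent_space M)" by auto
    then show ?thesis using tb_image[OF that, of "fst c \<inter> fst d"] by simp
  qed
  have op: "open (snd C ` (fst C \<inter> fst -` fst d))"
    and sm: "smooth_on (snd d \<circ> fst \<circ> chart_inv C) (snd C ` (fst C \<inter> fst -` fst d))"
    if C: "C \<in> atlas (tangent_bundle M)" and d: "d \<in> atlas M" for C d
  proof -
    obtain c where c: "C = tb_chart M c" "c \<in> atlas M" using C by auto
    let ?S = "snd c ` (fst c \<inter> fst d)"
    have o: "open (?S \<times> (UNIV :: 'e set))" using open_overlap[OF c(2) d] by (intro open_Times open_UNIV)
    then show "open (snd C ` (fst C \<inter> fst -` fst d))" by (simp only: im[OF c(2)] c(1))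
    have "smooth_on (\<lambda>z. (snd d \<circ> chart_inv c) (fst z)) (?S \<times> (UNIV :: 'e set))"
      by (rule smooth_on_compose[OF o open_overlap[OF c(2) d] _ _ smooth_transition[OF c(2) d]])
         (auto intro: smooth_on_bounded_linear[OF bounded_linear_fst o smooth_on_id[OF o]])
    then show "smooth_on (snd d \<circ> fst \<circ> chart_inv C) (snd C ` (fst C \<inter> fst -` fst d))"
      unfolding c(1) im[OF c(2)]
      by (rule smooth_on_cong[OF o, rotated]) (auto simp: chart_inv_tb[OF c(2)])
  qed
  have p: "fst w \<in> points M" using w by (auto simp: points_tangent_bundle)
  note D = differential_eq[OF smooth_atlas_tangent_bundle smooth_atlas_axioms op sm w p \<xi>, folded dproj_def]
  show "dproj M w \<xi> \<in> tangent_space M (fst w)" by (rule D(1))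
  assume c: "c \<in> atlas M" "fst w \<in> fst c"
  have o: "open (cdom c \<times> (UNIV :: 'e set))" using open_cdom[OF c(1)] by (intro open_Times open_UNIV)
  have w': "w \<in> fst (tb_chart M c)" using w c by (auto simp: points_tangent_bundle)
  then have z: "snd (tb_chart M c) w \<in> cdom c \<times> UNIV" by (auto simp: snd_tb_chart')
  have "dproj M w \<xi> c =
      frechet_derivative (snd c \<circ> fst \<circ> chart_inv (tb_chart M c)) (at (snd (tb_chart M c) w)) (\<xi> (tb_chart M c))"
    using D(2)[of "tb_chart M c" c] c w' by simp
  also have "frechet_derivative (snd c \<circ> fst \<circ> chart_inv (tb_chart M c)) (at (snd (tb_chart M c) w)) =
      frechet_derivative fst (at (snd (tb_chart M c) w))"
    by (rule frechet_derivative_cong[OF o z]) (use c fst_conv[OF c(1), of _ c] in \<open>auto simp: chart_chart_inv\<close>)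
  also have "\<dots> = fst" by (rule frechet_derivative_bounded_linear[OF bounded_linear_fst])
  finally show "dproj M w \<xi> c = fst (\<xi> (tb_chart M c))" .
qed

end


section \<open>Globally defined smooth functions and vector fields\<close>

definition lift_fun :: "('a, 'e) chart \<Rightarrow> ('e \<Rightarrow> real) \<Rightarrow> 'a \<Rightarrow> real" where
  "lift_fun c s q = (if q \<in> fst c then s (snd c q) else 0)"

definition lift_field :: "('a, 'e::euclidean_space) manifold \<Rightarrow> ('a, 'e) chart \<Rightarrow> ('e \<Rightarrow> 'e) \<Rightarrow> 'a \<Rightarrow> ('a, 'e) tvec" where
  "lift_field M c s q = (if q \<in> fst c then tvec_of M c q (s (snd c q)) else tzero)"

locale smooth_mfd =
  fixes M :: "('a, 'e::euclidean_space) manifold"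
  assumes smooth_manifold: "smooth_manifold M"
begin

lemma chart_homeomorphic:
  "c \<in> atlas M \<Longrightarrow> homeomorphic_map (subtopology (mtop M) (fst c)) (top_of_set (cdom c)) (snd c)"
  and chart_openin: "c \<in> atlas M \<Longrightarrow> openin (mtop M) (fst c)"
  and chart_open_cdom: "c \<in> atlas M \<Longrightarrow> open (cdom c)"
  using smooth_manifold by (auto simp: smooth_manifold_def)

lemma chart_topspace: "c \<in> atlas M \<Longrightarrow> topspace (subtopology (mtop M) (fst c)) = fst c"
  using openin_subset[OF chart_openin] by (simp add: inf.absorb2)

lemma chart_open_image:
  assumes "c \<in> atlas M" "openin (mtop M) T" "T \<subseteq> fst c"
  shows "open (snd c ` T)"
proof -
  have "openin (subtopology (mtop M) (fst c)) T"
    using assms by (simp add: openin_open_subtopology chart_openin)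
  then have "openin (top_of_set (cdom c)) (snd c ` T)"
    using homeomorphic_imp_open_map[OF chart_homeomorphic[OF assms(1)]] by (auto simp: open_map_def)
  then show ?thesis using chart_open_cdom[OF assms(1)] by (rule openin_open_trans)
qed

lemma chart_open_preimage:
  assumes "c \<in> atlas M" "open W"
  shows "openin (mtop M) {q \<in> fst c. snd c q \<in> W}"
proof -
  have "openin (subtopology (mtop M) (fst c))
      {q \<in> topspace (subtopology (mtop M) (fst c)). snd c q \<in> cdom c \<inter> W}"
    by (rule openin_continuous_map_preimage[OF homeomorphic_imp_continuous_map[OF chart_homeomorphic[OF assms(1)]]])
       (simp add: openin_open_Int assms)
  moreover have "{q \<in> topspace (subtopology (mtop M) (fst c)). snd c q \<in> cdom c \<inter> W} = {q \<in> fst c. snd c q \<in> W}"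
    unfolding chart_topspace[OF assms(1)] by auto
  ultimately show ?thesis using chart_openin[OF assms(1)] by (metis openin_trans_full)
qed

sublocale smooth_atlas M
proof
  show "points M = (\<Union>c\<in>atlas M. fst c)"
    using smooth_manifold by (simp add: smooth_manifold_def)
  show "inj_on (snd c) (fst c)" if "c \<in> atlas M" for c
    using homeomorphic_imp_injective_map[OF chart_homeomorphic[OF that]] chart_topspace[OF that] by simp
  show "open (snd c ` (fst c \<inter> fst d))" if "c \<in> atlas M" "d \<in> atlas M" for c d
    using that by (intro chart_open_image openin_Int chart_openin) auto
  show "smooth_on (snd d \<circ> chart_inv c) (snd c ` (fst c \<inter> fst d))" if "c \<in> atlas M" "d \<in> atlas M" for c d
    using smooth_manifold that by (simp add: smooth_manifold_def)
qed

lemma smooth_field_imp_vector_field: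
  assumes X: "smooth_field M X"
  shows "vector_field M X"
  unfolding vector_field_def smooth_map_def
proof (intro conjI ballI)
  have Xt: "\<forall>p\<in>points M. X p \<in> tangent_space M p" using X by (simp add: smooth_field_def)
  show "X p \<in> tangent_space M p" if "p \<in> points M" for p using Xt that by blast
  fix c D assume c: "c \<in> atlas M" and D: "D \<in> atlas (tangent_bundle M)"
  then obtain d where d: "D = tb_chart M d" "d \<in> atlas M" by auto
  show "smooth_on (snd D \<circ> tb_section X \<circ> chart_inv c) (snd c ` (fst c \<inter> tb_section X -` fst D))"
    unfolding d section_domain[OF Xt c] by (rule smooth_section[OF X c d(2)])
next
  note Xt = smooth_field_tangent[OF X]
  \<comment> \<open>Continuity into a generated topology is checked on the generators; the preimage
    of a generator is the chart preimage of an open set, found from the continuous graph map of the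
    field.\<close>
  let ?B = "{{w \<in> fst (tb_chart M c). snd (tb_chart M c) w \<in> W} | c W. c \<in> atlas M \<and> open W}"
  have "openin (mtop M) (tb_section X -` U \<inter> points M)" if U_B: "U \<in> ?B" for U
  proof -
    obtain c W where U: "U = {w \<in> fst (tb_chart M c). snd (tb_chart M c) w \<in> W}" "c \<in> atlas M" "open W"
      using U_B by blast
    let ?V = "cdom c \<inter> (\<lambda>x. (x, coord c X x)) -` W"
    have "continuous_on (cdom c) (\<lambda>x. (x, coord c X x))"
      by (intro continuous_intros smooth_on_imp_continuous_on smooth_field_coord X U)
    then have "open ?V" by (rule continuous_open_preimage[OF _ open_cdom[OF U(2)] U(3)])
    moreover have "tb_section X -` U \<inter> points M = {q \<in> fst c. snd c q \<in> ?V}"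
    proof -
      have "snd c q \<in> ?V \<longleftrightarrow> (snd c q, X q c) \<in> W" if "q \<in> fst c" for q
        using that U(2) by (simp add: coord_def chart_inv_chart)
      then have "{q \<in> fst c. snd c q \<in> ?V} = {q \<in> fst c. (snd c q, X q c) \<in> W}" by blast
      also have "\<dots> = tb_section X -` U \<inter> points M"
        unfolding U(1) using Xt chart_in_points[OF U(2)] by (auto simp: tb_section_def)
      finally show ?thesis by simp
    qed
    ultimately show ?thesis by (simp only: chart_open_preimage[OF U(2)])
  qed
  moreover have "tb_section X ` points M \<subseteq> points (tangent_bundle M)"
    using Xt by (auto simp: points_tangent_bundle tb_section_def)
  ultimately show "continuous_map (mtop M) (mtop (tangent_bundle M)) (tb_section X)"
    unfolding tangent_bundle_def by (auto simp: continuous_on_generated_topo_iff)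
qed

lemma vector_field_iff: "vector_field M X \<longleftrightarrow> smooth_field M X"
  using vector_field_imp_smooth_field smooth_field_imp_vector_field by blast

text \<open>The chart homeomorphism makes the set compact in \<open>M\<close>, and compact sets in a
  Hausdorff space are closed.\<close>

lemma chart_compact_closedin:
  assumes c: "c \<in> atlas M" and K: "compact K" "K \<subseteq> cdom c"
  shows "closedin (mtop M) {q \<in> fst c. snd c q \<in> K}"
proof -
  let ?U = "{q \<in> fst c. snd c q \<in> K}"
  have im: "snd c ` ?U = K" using K(2) by auto
  have "compactin (top_of_set (cdom c)) (snd c ` ?U)"
    unfolding im compactin_subtopology using K by auto
  then have "compactin (subtopology (mtop M) (fst c)) ?U"
    using homeomorphic_map_compactness[OF chart_homeomorphic[OF c], of ?U] chart_topspace[OF c] by auto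
  then have "compactin (mtop M) ?U" by (simp add: compactin_subtopology)
  then show ?thesis
    using smooth_manifold by (intro compactin_imp_closedin) (auto simp: smooth_manifold_def)
qed

text \<open>This is where the Hausdorff axiom enters: the compact support is closed in \<open>M\<close>.\<close>

lemma smooth_on_patch:
  assumes c: "c \<in> atlas M" and d: "d \<in> atlas M" and K: "compact K" "K \<subseteq> cdom c"
    and sm: "smooth_on h (snd d ` (fst c \<inter> fst d))"
    and zero: "\<And>q. q \<in> fst d \<Longrightarrow> q \<notin> fst c \<or> snd c q \<notin> K \<Longrightarrow> h (snd d q) = 0"
  shows "smooth_on h (cdom d)"
proof (rule smooth_on_locally)
  fix x assume "x \<in> cdom d"
  then obtain q where q: "q \<in> fst d" "x = snd d q" by auto
  show "\<exists>T. open T \<and> x \<in> T \<and> smooth_on h T"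
  proof (cases "q \<in> fst c")
    case True
    have "open (snd d ` (fst c \<inter> fst d))" using open_overlap[OF d c] by (simp add: Int_commute)
    then show ?thesis using True q sm by blast
  next
    case False
    let ?T = "snd d ` (fst d - {q \<in> fst c. snd c q \<in> K})"
    have o: "open ?T"
      by (rule chart_open_image[OF d openin_diff[OF chart_openin[OF d] chart_compact_closedin[OF c K]]]) auto
    have "smooth_on h ?T"
      by (rule smooth_on_cong[OF o _ smooth_on_const[of 0]]) (use zero in auto)
    then show ?thesis using o False q by blast
  qed
qed

lemma smooth_fun_lift_fun:
  assumes c: "c \<in> atlas M" and s: "smooth_on s (cdom c)" "csupp_on s (cdom c)"
  shows "smooth_fun M (lift_fun c s)"
  unfolding smooth_fun_def
proof
  fix d assume d: "d \<in> atlas M"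
  obtain K where K: "compact K" "K \<subseteq> cdom c" "\<And>x. x \<notin> K \<Longrightarrow> s x = 0"
    using s(2) by (auto simp: csupp_on_def)
  have od: "open (snd d ` (fst c \<inter> fst d))" using open_overlap[OF d c] by (simp add: Int_commute)
  have oc: "open (snd c ` (fst c \<inter> fst d))" by (rule open_overlap[OF c d])
  have "smooth_on s (snd c ` (fst c \<inter> fst d))" by (rule smooth_on_subset[OF s(1)]) auto
  then have "smooth_on (lift_fun c s \<circ> chart_inv c) (snd c ` (fst c \<inter> fst d))"
    by (rule smooth_on_cong[OF oc, rotated]) (use c in \<open>auto simp: lift_fun_def chart_inv_chart\<close>)
  then have "smooth_on (lift_fun c s \<circ> chart_inv d) (snd d ` (fst c \<inter> fst d))"
    by (intro smooth_change_chart[OF d c] od oc) auto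
  then show "smooth_on (lift_fun c s \<circ> chart_inv d) (cdom d)"
    by (rule smooth_on_patch[OF c d K(1,2)]) (use d K(3) in \<open>auto simp: lift_fun_def chart_inv_chart\<close>)
qed

lemma vector_field_lift_field:
  assumes c: "c \<in> atlas M" and s: "smooth_on s (cdom c)" "csupp_on s (cdom c)"
  shows "vector_field M (lift_field M c s)"
  unfolding vector_field_iff smooth_field_def
proof (intro conjI ballI)
  show "lift_field M c s p \<in> tangent_space M p" for p
    using c by (auto simp: lift_field_def tvec_of_in tzero_in)
  fix d assume d: "d \<in> atlas M"
  obtain K where K: "compact K" "K \<subseteq> cdom c" "\<And>x. x \<notin> K \<Longrightarrow> s x = 0"
    using s(2) by (auto simp: csupp_on_def)
  let ?h = "\<lambda>q. lift_field M c s q d"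
  have od: "open (snd d ` (fst c \<inter> fst d))" using open_overlap[OF d c] by (simp add: Int_commute)
  have oc: "open (snd c ` (fst c \<inter> fst d))" by (rule open_overlap[OF c d])
  have "smooth_on s (snd c ` (fst c \<inter> fst d))" by (rule smooth_on_subset[OF s(1)]) auto
  \<comment> \<open>On the overlap, the \<open>d\<close>-coordinate of the field is the derivative
    of the transition map applied to the moving vector \<open>s\<close>.\<close>
  from smooth_on_frechet_derivative_apply[OF oc smooth_transition[OF c d] this]
  have "smooth_on (?h \<circ> chart_inv c) (snd c ` (fst c \<inter> fst d))"
    by (rule smooth_on_cong[OF oc, rotated])
       (use c d in \<open>auto simp: lift_field_def chart_inv_chart tvec_of_def trans_deriv_def\<close>)
  then have "smooth_on (?h \<circ> chart_inv d) (snd d ` (fst c \<inter> fst d))"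
    by (intro smooth_change_chart[OF d c] od oc) auto
  then have "smooth_on (?h \<circ> chart_inv d) (cdom d)"
    by (rule smooth_on_patch[OF c d K(1,2)])
       (use c d K(3) in \<open>auto simp: lift_field_def chart_inv_chart tvec_of_0 tzero_def\<close>)
  then show "smooth_on (coord d (lift_field M c s)) (cdom d)"
    by (simp add: coord_def[abs_def] o_def)
qed

lemma lift_field_apply:
  "c \<in> atlas M \<Longrightarrow> q \<in> fst c \<Longrightarrow> lift_field M c s q c = s (snd c q)"
  by (simp add: lift_field_def tvec_of_apply)

lemma coord_lift_field: "c \<in> atlas M \<Longrightarrow> x \<in> cdom c \<Longrightarrow> coord c (lift_field M c s) x = s x"
  by (simp add: coord_def lift_field_apply chart_inv_in chart_chart_inv)

section \<open>Algebra of smooth functions and vector fields\<close>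

lemma smooth_fun_const: "smooth_fun M (\<lambda>q. a)"
  by (simp add: smooth_fun_def o_def smooth_on_const)

lemma smooth_fun_mult:
  "smooth_fun M f \<Longrightarrow> smooth_fun M h \<Longrightarrow> smooth_fun M (\<lambda>q. f q * h q)"
  unfolding smooth_fun_def o_def by (intro ballI smooth_on_mult open_cdom) auto

lemma vector_field_lincomb:
  assumes "smooth_fun M f" "smooth_fun M h" "vector_field M X" "vector_field M Y"
  shows "vector_field M (\<lambda>q. lincomb (f q) (X q) (h q) (Y q))"
  unfolding vector_field_iff smooth_field_def
proof (intro conjI ballI)
  show "lincomb (f p) (X p) (h p) (Y p) \<in> tangent_space M p" if "p \<in> points M" for p
    using assms that by (intro lincomb_in) (auto simp: vector_field_def)
  fix c assume c: "c \<in> atlas M"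
  have "smooth_on (\<lambda>x. (f \<circ> chart_inv c) x *\<^sub>R coord c X x + (h \<circ> chart_inv c) x *\<^sub>R coord c Y x) (cdom c)"
    using assms c unfolding vector_field_iff
    by (intro smooth_on_add smooth_on_scaleR open_cdom) (auto simp: smooth_field_def smooth_fun_def simp del: comp_apply)
  then show "smooth_on (coord c (\<lambda>q. lincomb (f q) (X q) (h q) (Y q))) (cdom c)"
    by (simp add: coord_def[abs_def] lincomb_def)
qed

lemma vector_field_tzero: "vector_field M (\<lambda>q. tzero)"
  unfolding vector_field_iff smooth_field_def coord_def[abs_def]
  by (auto simp: tzero_in) (simp add: tzero_def smooth_on_const)

lemma vector_field_sum:
  assumes "finite I" "\<And>i. i \<in> I \<Longrightarrow> smooth_fun M (f i)" "\<And>i. i \<in> I \<Longrightarrow> vector_field M (X i)"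
  shows "vector_field M (\<lambda>q c. \<Sum>i\<in>I. f i q *\<^sub>R X i q c)"
  using assms
proof (induction I rule: finite_induct)
  case empty
  then show ?case using vector_field_tzero by (simp add: tzero_def)
next
  case (insert i I)
  have "vector_field M (\<lambda>q. lincomb (f i q) (X i q) 1 (\<lambda>c. \<Sum>i\<in>I. f i q *\<^sub>R X i q c))"
    by (intro vector_field_lincomb smooth_fun_const) (use insert in auto)
  then show ?case using insert by (simp add: lincomb_def)
qed

section \<open>Vector fields with prescribed value and derivative at a point\<close>

lemma exists_bump_at:
  assumes "c \<in> atlas M" "p \<in> fst c"
  obtains \<beta> :: "'e \<Rightarrow> real" and V where "smooth_on \<beta> (cdom c)" "csupp_on \<beta> (cdom c)"
    "open V" "snd c p \<in> V" "V \<subseteq> cdom c" "\<And>x. x \<in> V \<Longrightarrow> \<beta> x = 1"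
proof -
  have "snd c p \<in> cdom c" using assms by simp
  from bump_exists[OF open_cdom[OF assms(1)] this] show thesis
    by (metis that smooth_on_subset subset_UNIV)
qed

text \<open>Value and first derivative at \<open>p\<close> are all that a section contributes to its
  differential there; multiplying by a bump function that is \<open>1\<close> near \<open>p\<close>
  changes neither.\<close>

lemma exists_vector_field_1jet:
  assumes c: "c \<in> atlas M" "p \<in> fst c" and s: "smooth_on s UNIV"
  obtains X where "vector_field M X" "X p c = s (snd c p)"
    "frechet_derivative (coord c X) (at (snd c p)) = frechet_derivative s (at (snd c p))"
proof -
  obtain \<beta> :: "'e \<Rightarrow> real" and V where \<beta>: "smooth_on \<beta> (cdom c)" "csupp_on \<beta> (cdom c)"
    "open V" "snd c p \<in> V" "V \<subseteq> cdom c" "\<And>x. x \<in> V \<Longrightarrow> \<beta> x = 1"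
    using exists_bump_at[OF c] by blast
  let ?X = "lift_field M c (\<lambda>x. \<beta> x *\<^sub>R s x)"
  have "vector_field M ?X"
    using c \<beta> s by (intro vector_field_lift_field smooth_on_scaleR csupp_on_scaleR open_cdom)
      (auto intro: smooth_on_subset)
  moreover have "?X p c = s (snd c p)" using c \<beta> by (simp add: lift_field_apply)
  moreover have "frechet_derivative (coord c ?X) (at (snd c p)) = frechet_derivative s (at (snd c p))"
    by (rule frechet_derivative_cong[OF \<beta>(3,4)]) (use \<beta> c in \<open>auto simp: coord_lift_field subset_iff\<close>)
  ultimately show thesis by (rule that)
qed

text \<open>Turns conditions on vector fields, such as the prescribed values of the metric on lifts,
  into conditions on single tangent vectors.\<close>

lemma exists_vector_field:
  assumes p: "p \<in> points M" and v: "v \<in> tangent_space M p"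
  obtains X where "vector_field M X" "X p = v"
proof -
  obtain c where c: "c \<in> atlas M" "p \<in> fst c" using point_in_chart[OF p] .
  obtain X where X: "vector_field M X" "X p c = v c"
    using exists_vector_field_1jet[OF c smooth_on_const] by blast
  then have "X p = v"
    using p by (intro tangent_vector_eqI[OF _ v c]) (auto simp: vector_field_def)
  with X that show thesis by blast
qed

end

section \<open>Christoffel symbols\<close>

locale affine_conn = smooth_mfd M
  for M :: "('a, 'e::euclidean_space) manifold" +
  fixes nabla :: "('a \<Rightarrow> ('a, 'e) tvec) \<Rightarrow> ('a \<Rightarrow> ('a, 'e) tvec) \<Rightarrow> 'a \<Rightarrow> ('a, 'e) tvec"
  assumes conn: "affine_connection M nabla"
begin

lemma nabla_vector_field: "vector_field M X \<Longrightarrow> vector_field M Y \<Longrightarrow> vector_field M (nabla X Y)"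
  by (rule conn[unfolded affine_connection_def, THEN conjunct1, rule_format])

lemma nabla_tangent:
  "vector_field M X \<Longrightarrow> vector_field M Y \<Longrightarrow> p \<in> points M \<Longrightarrow> nabla X Y p \<in> tangent_space M p"
  using nabla_vector_field unfolding vector_field_def by blast

lemma nabla_lincomb:
  "vector_field M X \<Longrightarrow> vector_field M X' \<Longrightarrow> vector_field M Y \<Longrightarrow> smooth_fun M f \<Longrightarrow> smooth_fun M h \<Longrightarrow>
    p \<in> points M \<Longrightarrow>
    nabla (\<lambda>q. lincomb (f q) (X q) (h q) (X' q)) Y p = lincomb (f p) (nabla X Y p) (h p) (nabla X' Y p)"
  by (rule conn[unfolded affine_connection_def, THEN conjunct2, THEN conjunct1, rule_format])

lemma nabla_add:
  "vector_field M X \<Longrightarrow> vector_field M Y \<Longrightarrow> vector_field M Y' \<Longrightarrow> p \<in> points M \<Longrightarrow>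
    nabla X (\<lambda>q. lincomb 1 (Y q) 1 (Y' q)) p = lincomb 1 (nabla X Y p) 1 (nabla X Y' p)"
  by (rule conn[unfolded affine_connection_def, THEN conjunct2, THEN conjunct2, THEN conjunct1, rule_format])

lemma nabla_leibniz:
  "vector_field M X \<Longrightarrow> vector_field M Y \<Longrightarrow> smooth_fun M f \<Longrightarrow> p \<in> points M \<Longrightarrow>
    nabla X (\<lambda>q. lincomb (f q) (Y q) 0 tzero) p =
      lincomb (dir_deriv M f p (X p)) (Y p) (f p) (nabla X Y p)"
  by (rule conn[unfolded affine_connection_def, THEN conjunct2, THEN conjunct2, THEN conjunct2, rule_format])

lemma nabla_sum_left:
  assumes "finite I" "\<And>i. i \<in> I \<Longrightarrow> smooth_fun M (f i)" "\<And>i. i \<in> I \<Longrightarrow> vector_field M (X i)"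
    and Y: "vector_field M Y" and p: "p \<in> points M"
  shows "nabla (\<lambda>q c. \<Sum>i\<in>I. f i q *\<^sub>R X i q c) Y p = (\<lambda>c. \<Sum>i\<in>I. f i p *\<^sub>R nabla (X i) Y p c)"
  using assms(1-3)
proof (induction I rule: finite_induct)
  case empty
  show ?case
    \<comment> \<open>The axioms speak of binary combinations only; the empty sum is one with both
      coefficients \<open>0\<close>.\<close>
    using nabla_lincomb[OF vector_field_tzero vector_field_tzero Y smooth_fun_const smooth_fun_const p, of 0 0]
    by (simp add: lincomb_def)
next
  case (insert i I)
  have "vector_field M (\<lambda>q c. \<Sum>i\<in>I. f i q *\<^sub>R X i q c)"
    using insert by (intro vector_field_sum) auto
  from nabla_lincomb[OF _ this Y _ smooth_fun_const p, of "X i" "f i" 1] show ?case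
    using insert by (simp add: lincomb_def)
qed

lemma nabla_sum_right:
  assumes "finite I" "\<And>i. i \<in> I \<Longrightarrow> smooth_fun M (f i)" "\<And>i. i \<in> I \<Longrightarrow> vector_field M (Y i)"
    and X: "vector_field M X" and p: "p \<in> points M"
  shows "nabla X (\<lambda>q c. \<Sum>i\<in>I. f i q *\<^sub>R Y i q c) p =
    (\<lambda>c. \<Sum>i\<in>I. dir_deriv M (f i) p (X p) *\<^sub>R Y i p c + f i p *\<^sub>R nabla X (Y i) p c)"
  using assms(1-3)
proof (induction I rule: finite_induct)
  case empty
  show ?case
    using nabla_leibniz[OF X vector_field_tzero smooth_fun_const p, of 0]
    by (simp add: lincomb_def tzero_def)
next
  case (insert i I)
  have 1: "vector_field M (\<lambda>q c. \<Sum>i\<in>I. f i q *\<^sub>R Y i q c)"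
    using insert by (intro vector_field_sum) auto
  have 2: "vector_field M (\<lambda>q. lincomb (f i q) (Y i q) 0 tzero)"
    using insert by (intro vector_field_lincomb smooth_fun_const vector_field_tzero) auto
  have eq: "(\<lambda>q c. \<Sum>i\<in>insert i I. f i q *\<^sub>R Y i q c) =
      (\<lambda>q. lincomb 1 (lincomb (f i q) (Y i q) 0 tzero) 1 (\<lambda>c. \<Sum>i\<in>I. f i q *\<^sub>R Y i q c))"
    using insert by (simp add: lincomb_def tzero_def)
  have "nabla X (\<lambda>q. lincomb (f i q) (Y i q) 0 tzero) p =
      lincomb (dir_deriv M (f i) p (X p)) (Y i p) (f i p) (nabla X (Y i) p)"
    using insert by (intro nabla_leibniz X p) auto
  then show ?case
    unfolding eq nabla_add[OF X 2 1 p] using insert by (simp add: lincomb_def)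
qed

lemma linear_tvec_of:
  assumes "c \<in> atlas M" "q \<in> fst c"
  shows "linear (\<lambda>y. tvec_of M c q y d)"
proof (cases "d \<in> atlas M \<and> q \<in> fst d")
  case True
  then show ?thesis using linear_trans_deriv[of c d q] assms by (simp add: tvec_of_def)
next
  case False
  then have "(\<lambda>y. tvec_of M c q y d) = (\<lambda>y. 0)" unfolding tvec_of_def by auto
  then show ?thesis by (simp add: linear_iff)
qed

abbreviation frame :: "('a, 'e) chart \<Rightarrow> ('e \<Rightarrow> real) \<Rightarrow> 'e \<Rightarrow> 'a \<Rightarrow> ('a, 'e) tvec" where
  "frame c \<beta> i \<equiv> lift_field M c (\<lambda>x. \<beta> x *\<^sub>R i)"

abbreviation coeff :: "('a, 'e) chart \<Rightarrow> ('e \<Rightarrow> real) \<Rightarrow> ('a \<Rightarrow> ('a, 'e) tvec) \<Rightarrow> 'e \<Rightarrow> 'a \<Rightarrow> real" where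
  "coeff c \<beta> Z i \<equiv> lift_fun c (\<lambda>x. \<beta> x * (coord c Z x \<bullet> i))"

text \<open>Multiplying by \<open>\<beta>\<^sup>2\<close> turns the local decomposition of \<open>Z\<close> in the coordinate frame into one with
  globally defined coefficients and fields, to which the axioms of the connection apply.\<close>

lemma frame_decomposition:
  assumes c: "c \<in> atlas M" and Z: "vector_field M Z"
  shows "(\<lambda>q. lincomb (lift_fun c \<beta> q * lift_fun c \<beta> q) (Z q) 0 tzero) =
    (\<lambda>q d. \<Sum>i\<in>Basis. coeff c \<beta> Z i q *\<^sub>R frame c \<beta> i q d)"
proof (intro ext)
  fix q d
  show "lincomb (lift_fun c \<beta> q * lift_fun c \<beta> q) (Z q) 0 tzero d =
      (\<Sum>i\<in>Basis. coeff c \<beta> Z i q *\<^sub>R frame c \<beta> i q d)"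
  proof (cases "q \<in> fst c")
    case True
    let ?\<beta> = "\<beta> (snd c q)"
    note lin = linear_tvec_of[OF c True, of d]
    have "Z q \<in> tangent_space M q" using Z chart_in_points[OF c True] by (simp add: vector_field_def)
    then have "Z q d = tvec_of M c q (Z q c) d" by (simp add: tvec_of_tangent c True)
    also have "\<dots> = (\<Sum>i\<in>Basis. (Z q c \<bullet> i) *\<^sub>R tvec_of M c q i d)"
      by (rule linear_eq_sum_Basis[OF lin])
    finally have "(?\<beta> * ?\<beta>) *\<^sub>R Z q d = (\<Sum>i\<in>Basis. (?\<beta> * (Z q c \<bullet> i)) *\<^sub>R tvec_of M c q (?\<beta> *\<^sub>R i) d)"
      by (simp add: scaleR_sum_right linear_cmul[OF lin] mult_ac)
    then show ?thesis
      using True c by (simp add: lift_fun_def lift_field_def lincomb_def coord_def chart_inv_chart)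
  qed (simp add: lift_fun_def lincomb_def)
qed

definition cutoff :: "('a, 'e) chart \<Rightarrow> ('e \<Rightarrow> real) \<Rightarrow> 'e set \<Rightarrow> bool" where
  "cutoff c \<beta> V \<longleftrightarrow> smooth_on \<beta> (cdom c) \<and> csupp_on \<beta> (cdom c) \<and> open V \<and> V \<subseteq> cdom c \<and> (\<forall>x\<in>V. \<beta> x = 1)"

lemma vector_field_frame: "c \<in> atlas M \<Longrightarrow> cutoff c \<beta> V \<Longrightarrow> vector_field M (frame c \<beta> i)"
  unfolding cutoff_def
  by (intro vector_field_lift_field smooth_on_scaleR csupp_on_scaleR open_cdom smooth_on_const) auto

lemma smooth_fun_coeff:
  "c \<in> atlas M \<Longrightarrow> cutoff c \<beta> V \<Longrightarrow> vector_field M Z \<Longrightarrow> smooth_fun M (coeff c \<beta> Z i)"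
  unfolding cutoff_def vector_field_iff
  by (intro smooth_fun_lift_fun smooth_on_mult csupp_on_mult open_cdom smooth_on_inner_left)
     (auto simp: smooth_field_def)

lemma smooth_fun_cutoff: "c \<in> atlas M \<Longrightarrow> cutoff c \<beta> V \<Longrightarrow> smooth_fun M (lift_fun c \<beta>)"
  unfolding cutoff_def by (intro smooth_fun_lift_fun) auto

lemma frame_apply:
  "c \<in> atlas M \<Longrightarrow> cutoff c \<beta> V \<Longrightarrow> q \<in> fst c \<Longrightarrow> snd c q \<in> V \<Longrightarrow> frame c \<beta> i q c = i"
  by (simp add: lift_field_apply cutoff_def)

lemma coeff_apply:
  "c \<in> atlas M \<Longrightarrow> cutoff c \<beta> V \<Longrightarrow> q \<in> fst c \<Longrightarrow> snd c q \<in> V \<Longrightarrow> coeff c \<beta> Z i q = Z q c \<bullet> i"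
  by (simp add: lift_fun_def coord_def chart_inv_chart cutoff_def)

text \<open>The squared cutoff passes out of the first slot and is \<open>1\<close> at
  \<open>q\<close>, so \<open>X\<close> may be replaced by its frame decomposition. Hence only the
  value of \<open>X\<close> at \<open>q\<close> enters.\<close>

lemma nabla_tensorial:
  assumes c: "c \<in> atlas M" "cutoff c \<beta> V" and q: "q \<in> fst c" "snd c q \<in> V"
    and X: "vector_field M X" and Y: "vector_field M Y"
  shows "nabla X Y q d = (\<Sum>j\<in>Basis. (X q c \<bullet> j) *\<^sub>R nabla (frame c \<beta> j) Y q d)"
proof -
  let ?b = "\<lambda>q. lift_fun c \<beta> q * lift_fun c \<beta> q"
  have p: "q \<in> points M" by (rule chart_in_points[OF c(1) q(1)])
  have b: "smooth_fun M ?b" by (intro smooth_fun_mult smooth_fun_cutoff[OF c])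
  have b1: "?b q = 1" using q c by (simp add: lift_fun_def cutoff_def)
  have "nabla (\<lambda>q. lincomb (?b q) (X q) 0 tzero) Y q = nabla X Y q"
    using nabla_lincomb[OF X vector_field_tzero Y b smooth_fun_const p, of 0] b1 by (simp add: lincomb_def)
  moreover have "nabla (\<lambda>q d. \<Sum>j\<in>Basis. coeff c \<beta> X j q *\<^sub>R frame c \<beta> j q d) Y q d =
      (\<Sum>j\<in>Basis. coeff c \<beta> X j q *\<^sub>R nabla (frame c \<beta> j) Y q d)"
    by (subst nabla_sum_left[OF finite_Basis smooth_fun_coeff[OF c X] vector_field_frame[OF c] Y p]) simp
  ultimately show ?thesis
    by (simp add: frame_decomposition[OF c(1) X] coeff_apply[OF c q])
qed

text \<open>The frame decomposition, now in the second slot. In the Leibniz rule the derivatives of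
  the coefficients reassemble to the derivative of \<open>coord c Z\<close>, and the remaining terms
  are the Christoffel part.\<close>

lemma nabla_coord_frame:
  assumes c: "c \<in> atlas M" "cutoff c \<beta> V" and q: "q \<in> fst c" "snd c q \<in> V"
    and X: "vector_field M X" and Z: "vector_field M Z"
  shows "nabla X Z q c = frechet_derivative (coord c Z) (at (snd c q)) (X q c) +
    (\<Sum>i\<in>Basis. \<Sum>j\<in>Basis. ((X q c \<bullet> j) * (Z q c \<bullet> i)) *\<^sub>R nabla (frame c \<beta> j) (frame c \<beta> i) q c)"
proof -
  let ?b = "\<lambda>q. lift_fun c \<beta> q * lift_fun c \<beta> q" and ?x = "snd c q"
  let ?D = "frechet_derivative (coord c Z) (at ?x) (X q c)"
  have p: "q \<in> points M" by (rule chart_in_points[OF c(1) q(1)])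
  have V: "open V" "V \<subseteq> cdom c" "\<And>x. x \<in> V \<Longrightarrow> \<beta> x = 1" using c(2) by (auto simp: cutoff_def)
  have Xt: "X q \<in> tangent_space M q" using X p by (simp add: vector_field_def)
  have b: "smooth_fun M ?b" by (intro smooth_fun_mult smooth_fun_cutoff[OF c])
  have b1: "?b q = 1" using q c by (simp add: lift_fun_def cutoff_def)
  \<comment> \<open>Here the cutoff must be \<open>1\<close> near \<open>q\<close> and not only at
    \<open>q\<close>: its derivative has to vanish.\<close>
  have "frechet_derivative (?b \<circ> chart_inv c) (at ?x) = frechet_derivative (\<lambda>x. 1) (at ?x)"
    by (rule frechet_derivative_cong[OF V(1) q(2)])
       (use V in \<open>auto simp: lift_fun_def chart_inv_in chart_chart_inv subset_iff\<close>)
  then have "dir_deriv M ?b q (X q) = 0" by (simp add: dir_deriv_eq[OF b Xt c(1) q(1)])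
  then have lhs: "nabla X (\<lambda>q. lincomb (?b q) (Z q) 0 tzero) q = nabla X Z q"
    using nabla_leibniz[OF X Z b p] b1 by (simp add: lincomb_def)
  have "dir_deriv M (coeff c \<beta> Z i) q (X q) = ?D \<bullet> i" for i
  proof -
    have diff: "coord c Z differentiable (at ?x)"
      using Z c(1) q(1) smooth_on_imp_differentiable[of "coord c Z" "cdom c" ?x]
      by (simp add: vector_field_iff smooth_field_def)
    have "frechet_derivative (coeff c \<beta> Z i \<circ> chart_inv c) (at ?x) =
        frechet_derivative (\<lambda>x. coord c Z x \<bullet> i) (at ?x)"
      by (rule frechet_derivative_cong[OF V(1) q(2)])
         (use V in \<open>auto simp: lift_fun_def chart_inv_in chart_chart_inv subset_iff\<close>)
    also have "\<dots> = (\<lambda>v. frechet_derivative (coord c Z) (at ?x) v \<bullet> i)"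
      using diff by (intro frechet_derivative_at[symmetric] bounded_linear.has_derivative[OF bounded_linear_inner_left])
        (simp add: frechet_derivative_works)
    finally show ?thesis
      by (simp add: dir_deriv_eq[OF smooth_fun_coeff[OF c Z] Xt c(1) q(1)])
  qed
  then have "nabla X (\<lambda>q d. \<Sum>i\<in>Basis. coeff c \<beta> Z i q *\<^sub>R frame c \<beta> i q d) q c =
      (\<Sum>i\<in>Basis. (?D \<bullet> i) *\<^sub>R i + (Z q c \<bullet> i) *\<^sub>R nabla X (frame c \<beta> i) q c)"
    by (subst nabla_sum_right[OF finite_Basis smooth_fun_coeff[OF c Z] vector_field_frame[OF c] X p])
       (simp add: frame_apply[OF c q] coeff_apply[OF c q])
  also have "\<dots> = ?D + (\<Sum>i\<in>Basis. (Z q c \<bullet> i) *\<^sub>R nabla X (frame c \<beta> i) q c)"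
    by (simp add: sum.distrib euclidean_representation)
  also have "(\<Sum>i\<in>Basis. (Z q c \<bullet> i) *\<^sub>R nabla X (frame c \<beta> i) q c) =
      (\<Sum>i\<in>Basis. \<Sum>j\<in>Basis. ((X q c \<bullet> j) * (Z q c \<bullet> i)) *\<^sub>R nabla (frame c \<beta> j) (frame c \<beta> i) q c)"
    by (subst nabla_tensorial[OF c q X vector_field_frame[OF c]]) (simp add: scaleR_sum_right mult_ac)
  finally show ?thesis
    using lhs by (simp add: frame_decomposition[OF c(1) Z])
qed

definition is_christoffel :: "('a, 'e) chart \<Rightarrow> ('e \<Rightarrow> 'e \<Rightarrow> 'e \<Rightarrow> 'e) \<Rightarrow> bool" where
  "is_christoffel c \<Gamma> \<longleftrightarrow>
     (\<forall>q\<in>fst c. \<forall>X Z. vector_field M X \<longrightarrow> vector_field M Z \<longrightarrow>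
        nabla X Z q c = frechet_derivative (coord c Z) (at (snd c q)) (X q c) + \<Gamma> (snd c q) (X q c) (Z q c)) \<and>
     (\<forall>x\<in>cdom c. bilinear (\<Gamma> x)) \<and> (\<forall>a b. smooth_on (\<lambda>x. \<Gamma> x a b) (cdom c))"

text \<open>\<Gamma> at \<open>x\<close> is computed with the cutoff \<open>B x\<close>, chosen for
  each \<open>x\<close> separately and with no regularity in \<open>x\<close>. Smoothness is
  recovered because the value does not depend on the cutoff, so that one cutoff can be used around
  each point.\<close>

lemma exists_christoffel:
  assumes c: "c \<in> atlas M"
  shows "\<exists>\<Gamma>. is_christoffel c \<Gamma>"
proof -
  define G where "G \<beta> x a b = (\<Sum>i\<in>Basis. \<Sum>j\<in>Basis. ((a \<bullet> j) * (b \<bullet> i)) *\<^sub>R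
    coord c (nabla (frame c \<beta> j) (frame c \<beta> i)) x)" for \<beta> x a b
  have "\<forall>x\<in>cdom c. \<exists>\<beta> V. cutoff c \<beta> V \<and> x \<in> V"
  proof
    fix x assume x: "x \<in> cdom c"
    obtain \<beta> :: "'e \<Rightarrow> real" and V where \<beta>: "smooth_on \<beta> (cdom c)" "csupp_on \<beta> (cdom c)"
      "open V" "snd c (chart_inv c x) \<in> V" "V \<subseteq> cdom c" "\<And>x. x \<in> V \<Longrightarrow> \<beta> x = 1"
      using exists_bump_at[OF c chart_inv_in[OF x]] by blast
    then show "\<exists>\<beta> V. cutoff c \<beta> V \<and> x \<in> V"
      unfolding cutoff_def using chart_chart_inv[OF x] by metis
  qed
  then obtain B W where BW: "\<And>x. x \<in> cdom c \<Longrightarrow> cutoff c (B x) (W x) \<and> x \<in> W x" by metis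
  have formula: "nabla X Z q c = frechet_derivative (coord c Z) (at (snd c q)) (X q c) + G \<beta> (snd c q) (X q c) (Z q c)"
    if "cutoff c \<beta> V" "q \<in> fst c" "snd c q \<in> V" "vector_field M X" "vector_field M Z" for \<beta> V q X Z
    using nabla_coord_frame[OF c that] c that(2) by (simp add: G_def coord_def chart_inv_chart)
  \<comment> \<open>Both cutoffs are \<open>1\<close> near \<open>x\<close>, so both values complete
    the same derivative term to the same \<open>nabla X Z\<close>, where \<open>X\<close> and
    \<open>Z\<close> have coordinates \<open>a\<close> and \<open>b\<close> at
    \<open>x\<close>.\<close>
  have "G (B x0) x a b = G (B x) x a b" if x0: "x0 \<in> cdom c" and x: "x \<in> W x0" for x0 x a b
  proof -
    have xc: "x \<in> cdom c" using BW[OF x0] x by (auto simp: cutoff_def)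
    let ?q = "chart_inv c x"
    have q: "?q \<in> fst c" "snd c ?q = x" using xc by (simp_all add: chart_inv_in chart_chart_inv)
    obtain X where X: "vector_field M X" "X ?q c = a"
      using exists_vector_field_1jet[OF c q(1) smooth_on_const] by blast
    obtain Z where Z: "vector_field M Z" "Z ?q c = b"
      using exists_vector_field_1jet[OF c q(1) smooth_on_const] by blast
    from formula[of "B x0" "W x0" ?q X Z] formula[of "B x" "W x" ?q X Z] BW[OF x0] BW[OF xc] q X Z x
    show ?thesis by simp
  qed
  note indep = this
  have "smooth_on (\<lambda>x. G (B x) x a b) (cdom c)" for a b
  proof (rule smooth_on_locally)
    fix x0 assume x0: "x0 \<in> cdom c"
    have W: "open (W x0)" "W x0 \<subseteq> cdom c" using BW[OF x0] by (auto simp: cutoff_def)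
    have "smooth_on (coord c (nabla (frame c (B x0) j) (frame c (B x0) i))) (cdom c)" for i j
      using nabla_vector_field[OF vector_field_frame[OF c] vector_field_frame[OF c]] BW[OF x0] c
      unfolding vector_field_iff smooth_field_def by blast
    have "smooth_on (\<lambda>x. G (B x0) x a b) (cdom c)"
      unfolding G_def
      by (intro smooth_on_sum smooth_on_scaleR smooth_on_const open_cdom[OF c])
         (use \<open>\<And>i j. smooth_on (coord c (nabla (frame c (B x0) j) (frame c (B x0) i))) (cdom c)\<close> in simp)
    then have "smooth_on (\<lambda>x. G (B x) x a b) (W x0)"
      by (intro smooth_on_cong[OF W(1) indep[OF x0] smooth_on_subset[OF _ W(2)]])
    then show "\<exists>T. open T \<and> x0 \<in> T \<and> smooth_on (\<lambda>x. G (B x) x a b) T"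
      using W BW[OF x0] by blast
  qed
  moreover have "bilinear (G \<beta> x)" for \<beta> x
    unfolding bilinear_def G_def linear_iff
    by (simp add: inner_add_left distrib_left distrib_right scaleR_add_left sum.distrib scaleR_sum_right mult_ac)
  ultimately have "is_christoffel c (\<lambda>x. G (B x) x)"
    unfolding is_christoffel_def using formula BW by blast
  then show ?thesis by blast
qed

definition christoffel :: "('a, 'e) chart \<Rightarrow> 'e \<Rightarrow> 'e \<Rightarrow> 'e \<Rightarrow> 'e" where
  "christoffel c = (SOME \<Gamma>. is_christoffel c \<Gamma>)"

lemma is_christoffel: "c \<in> atlas M \<Longrightarrow> is_christoffel c (christoffel c)"
  unfolding christoffel_def by (rule someI_ex[OF exists_christoffel])

lemma nabla_coord:
  "c \<in> atlas M \<Longrightarrow> q \<in> fst c \<Longrightarrow> vector_field M X \<Longrightarrow> vector_field M Z \<Longrightarrow>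
    nabla X Z q c =
      frechet_derivative (coord c Z) (at (snd c q)) (X q c) + christoffel c (snd c q) (X q c) (Z q c)"
  using is_christoffel unfolding is_christoffel_def by blast

lemma bilinear_christoffel: "c \<in> atlas M \<Longrightarrow> x \<in> cdom c \<Longrightarrow> bilinear (christoffel c x)"
  using is_christoffel unfolding is_christoffel_def by blast

lemma smooth_christoffel: "c \<in> atlas M \<Longrightarrow> smooth_on (\<lambda>x. christoffel c x a b) (cdom c)"
  using is_christoffel unfolding is_christoffel_def by blast

end

section \<open>The connection map and the lifts\<close>

context affine_conn
begin

interpretation TM: smooth_atlas "tangent_bundle M"
  by (rule smooth_atlas_tangent_bundle)

text \<open>The coordinates of \<open>dZ (X)\<close> are \<open>X p c\<close> and the derivative of
  \<open>Z\<close> in that direction. If the first is \<open>0\<close> then so is the second;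
  otherwise the second can be made arbitrary by the choice of \<open>Z\<close>.\<close>

lemma tangent_is_differential_section:
  assumes c: "c \<in> atlas M" "p \<in> fst c" and u: "u \<in> tangent_space M p"
    and \<xi>: "\<xi> \<in> tangent_space (tangent_bundle M) (p, u)" and nz: "fst (\<xi> (tb_chart M c)) \<noteq> 0"
  obtains X Z where "vector_field M X" "vector_field M Z" "Z p = u"
    "\<xi> = differential M (tangent_bundle M) (tb_section Z) p (X p)"
proof -
  have p: "p \<in> points M" by (rule chart_in_points[OF c])
  let ?C = "tb_chart M c"
  define a where "a = fst (\<xi> ?C)"
  define b where "b = snd (\<xi> ?C)"
  let ?x = "snd c p"
  \<comment> \<open>The affine map with value \<open>u c\<close> at \<open>?x\<close> whose
    derivative is \<open>b\<close> times the coefficient of the projection onto \<open>a\<close>;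
    thus it sends \<open>a\<close> to \<open>b\<close>. The division by \<open>a \<bullet> a\<close>
    uses that \<open>a\<close> is nonzero.\<close>
  define s where "s x = u c + ((x + (- ?x)) \<bullet> a) *\<^sub>R (inverse (a \<bullet> a) *\<^sub>R b)" for x
  have "smooth_on s UNIV"
    unfolding s_def[abs_def]
    by (intro smooth_on_add smooth_on_scaleR smooth_on_const smooth_on_inner_left smooth_on_id open_UNIV)
  then obtain Z where Z: "vector_field M Z" "Z p c = s ?x"
    "frechet_derivative (coord c Z) (at ?x) = frechet_derivative s (at ?x)"
    using exists_vector_field_1jet[OF c] by metis
  obtain X where X: "vector_field M X" "X p c = a"
    using exists_vector_field_1jet[OF c smooth_on_const] by blast
  have Xt: "X p \<in> tangent_space M p" and Zt: "Z p \<in> tangent_space M p"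
    using X(1) Z(1) p by (auto simp: vector_field_def)
  have Zp: "Z p = u"
    by (rule tangent_vector_eqI[OF Zt u c]) (simp add: Z(2) s_def)
  have "(s has_derivative (\<lambda>v. (v \<bullet> a) *\<^sub>R (inverse (a \<bullet> a) *\<^sub>R b))) (at ?x)"
    unfolding s_def[abs_def] by (auto intro!: derivative_eq_intros)
  then have "frechet_derivative s (at ?x) a = (a \<bullet> a) *\<^sub>R (inverse (a \<bullet> a) *\<^sub>R b)"
    using frechet_derivative_at by metis
  also have "\<dots> = b" using nz by (simp add: a_def)
  finally have D: "frechet_derivative (coord c Z) (at ?x) (X p c) = b" by (simp add: Z(3) X(2))
  have pu: "(p, u) \<in> fst ?C" using c u by simp
  note ds = differential_section[OF vector_field_imp_smooth_field[OF Z(1)] p Xt]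
  have "\<xi> = differential M (tangent_bundle M) (tb_section Z) p (X p)"
    by (rule TM.tangent_vector_eqI[OF \<xi> _ _ pu])
       (use ds(1) ds(2)[OF c] c D X(2) Zp in \<open>auto simp: a_def b_def\<close>)
  with X(1) Z(1) Zp show thesis by (rule that)
qed

text \<open>The connection map as computed in one chart. Independence of the chart is never
  calculated; it follows once each of these is identified with the map that
  \<open>connection_map\<close> describes.\<close>

definition chart_conn ::
  "('a, 'e) chart \<Rightarrow> 'a \<times> ('a, 'e) tvec \<Rightarrow> ('a \<times> ('a, 'e) tvec, 'e \<times> 'e) tvec \<Rightarrow> ('a, 'e) tvec" where
  "chart_conn c w \<xi> = tvec_of M c (fst w)
     (snd (\<xi> (tb_chart M c)) + christoffel c (snd c (fst w)) (fst (\<xi> (tb_chart M c))) (snd w c))"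

lemma chart_conn_in: "c \<in> atlas M \<Longrightarrow> fst w \<in> fst c \<Longrightarrow> chart_conn c w \<xi> \<in> tangent_space M (fst w)"
  by (simp add: chart_conn_def tvec_of_in)

lemma chart_conn_lincomb:
  assumes c: "c \<in> atlas M" "fst w \<in> fst c"
  shows "chart_conn c w (lincomb a \<xi> b \<eta>) = lincomb a (chart_conn c w \<xi>) b (chart_conn c w \<eta>)"
proof -
  have B: "bilinear (christoffel c (snd c (fst w)))" using c by (intro bilinear_christoffel) auto
  show ?thesis
    unfolding chart_conn_def tvec_of_lincomb[OF c, symmetric]
    by (simp add: lincomb_def bilinear_ladd[OF B] bilinear_lmul[OF B] scaleR_add_right add_ac)
qed

lemma chart_conn_differential_section:
  assumes c: "c \<in> atlas M" "p \<in> fst c" and X: "vector_field M X" and Z: "vector_field M Z"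
  shows "chart_conn c (p, Z p) (differential M (tangent_bundle M) (tb_section Z) p (X p)) = nabla X Z p"
proof -
  have p: "p \<in> points M" by (rule chart_in_points[OF c])
  have Xt: "X p \<in> tangent_space M p" using X p by (auto simp: vector_field_def)
  note ds = differential_section(2)[OF vector_field_imp_smooth_field[OF Z] p Xt c]
  show ?thesis
    by (rule tangent_vector_eqI[OF _ nabla_tangent[OF X Z p] c])
       (use c in \<open>auto simp: chart_conn_def tvec_of_in tvec_of_apply ds nabla_coord[OF c X Z]\<close>)
qed

text \<open>Vectors with nonzero horizontal part are of the form \<open>dZ (X)\<close>; the others are differences of two
  such.\<close>

lemma connection_map_eq_chart_conn:
  assumes c: "c \<in> atlas M" "p \<in> fst c" and u: "u \<in> tangent_space M p"
  shows "connection_map M nabla (p, u) = restrict (chart_conn c (p, u)) (tangent_space (tangent_bundle M) (p, u))"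
  unfolding connection_map_def prod.case
proof (rule the_equality, intro conjI ballI allI impI)
  let ?T = "tangent_space (tangent_bundle M) (p, u)"
  let ?K = "restrict (chart_conn c (p, u)) ?T"
  have p: "p \<in> points M" by (rule chart_in_points[OF c])
  have pu: "(p, u) \<in> fst (tb_chart M c)" using c u by simp
  have C: "tb_chart M c \<in> atlas (tangent_bundle M)" using c by simp
  show "?K \<in> ?T \<rightarrow>\<^sub>E tangent_space M p"
    using chart_conn_in[of c "(p, u)"] c by auto
  show "?K (lincomb a \<xi> b \<eta>) = lincomb a (?K \<xi>) b (?K \<eta>)" if "\<xi> \<in> ?T" "\<eta> \<in> ?T" for \<xi> \<eta> a b
    using TM.lincomb_in[OF that] that c by (simp add: chart_conn_lincomb)
  show "?K (differential M (tangent_bundle M) (tb_section Z) p (X p)) = nabla X Z p"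
    if "vector_field M X" "vector_field M Z" "Z p = u" for X Z
  proof -
    have Xt: "X p \<in> tangent_space M p" using that(1) p by (auto simp: vector_field_def)
    show ?thesis
      using differential_section(1)[OF vector_field_imp_smooth_field[OF that(2)] p Xt]
        chart_conn_differential_section[OF c that(1,2)] that(3) by simp
  qed
  fix K assume K: "K \<in> ?T \<rightarrow>\<^sub>E tangent_space M p \<and>
       (\<forall>\<xi>\<in>?T. \<forall>\<eta>\<in>?T. \<forall>a b. K (lincomb a \<xi> b \<eta>) = lincomb a (K \<xi>) b (K \<eta>)) \<and>
       (\<forall>X Z. vector_field M X \<longrightarrow> vector_field M Z \<longrightarrow> Z p = u \<longrightarrow>
          K (differential M (tangent_bundle M) (tb_section Z) p (X p)) = nabla X Z p)"
  note K_lincomb = K[THEN conjunct2, THEN conjunct1, rule_format]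
    and K_section = K[THEN conjunct2, THEN conjunct2, rule_format]
  have K_outside: "K \<xi> = undefined" if "\<xi> \<notin> ?T" for \<xi>
    using PiE_arb[OF K[THEN conjunct1] that] .
  have nonzero: "K \<xi> = chart_conn c (p, u) \<xi>" if \<xi>: "\<xi> \<in> ?T" "fst (\<xi> (tb_chart M c)) \<noteq> 0" for \<xi>
  proof -
    obtain X Z where XZ: "vector_field M X" "vector_field M Z" "Z p = u"
      "\<xi> = differential M (tangent_bundle M) (tb_section Z) p (X p)"
      using tangent_is_differential_section[OF c u \<xi>] by blast
    have "K \<xi> = nabla X Z p" using K_section[OF XZ(1-3)] XZ(4) by simp
    then show ?thesis using chart_conn_differential_section[OF c XZ(1,2)] XZ(3,4) by simp
  qed
  have all: "K \<xi> = chart_conn c (p, u) \<xi>" if \<xi>: "\<xi> \<in> ?T" for \<xi>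
  proof (cases "fst (\<xi> (tb_chart M c)) = 0")
    case False
    then show ?thesis using nonzero[OF \<xi>] by simp
  next
    case True
    obtain i :: 'e where i: "i \<in> Basis" using nonempty_Basis by blast
    \<comment> \<open>Its horizontal part is a basis vector, so that \<xi> being vertical,
      \<open>?\<eta>\<close> and \<open>?\<zeta>\<close> both have the nonzero horizontal part
      \<open>i\<close>.\<close>
    let ?\<eta> = "tvec_of (tangent_bundle M) (tb_chart M c) (p, u) (i, 0)"
    have \<eta>: "?\<eta> \<in> ?T" "?\<eta> (tb_chart M c) = (i, 0)"
      by (rule TM.tvec_of_in[OF C pu], rule TM.tvec_of_apply[OF C pu])
    let ?\<zeta> = "lincomb 1 \<xi> 1 ?\<eta>"
    have \<zeta>: "?\<zeta> \<in> ?T" by (rule TM.lincomb_in[OF \<xi> \<eta>(1)])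
    have eq: "lincomb 1 ?\<zeta> (-1) ?\<eta> = \<xi>" by (simp add: lincomb_def)
    have "K \<xi> = lincomb 1 (K ?\<zeta>) (-1) (K ?\<eta>)"
      using K_lincomb[OF \<zeta> \<eta>(1), of 1 "-1"] by (simp only: eq)
    also have "\<dots> = lincomb 1 (chart_conn c (p, u) ?\<zeta>) (-1) (chart_conn c (p, u) ?\<eta>)"
      using nonzero[OF \<zeta>] nonzero[OF \<eta>(1)] True i \<eta>(2) by (simp add: lincomb_def nonzero_Basis)
    also have "\<dots> = chart_conn c (p, u) \<xi>"
      using chart_conn_lincomb[of c "(p, u)" 1 ?\<zeta> "-1" ?\<eta>] c by (simp only: eq fst_conv)
    finally show ?thesis .
  qed
  show "K = ?K"
  proof
    fix \<xi> show "K \<xi> = ?K \<xi>"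
      using K_outside all by (cases "\<xi> \<in> ?T") simp_all
  qed
qed

section \<open>Projection and connection map together as an isomorphism; the lifts\<close>

lemma connection_map_in:
  assumes w: "w \<in> points (tangent_bundle M)" and \<xi>: "\<xi> \<in> tangent_space (tangent_bundle M) w"
  shows "connection_map M nabla w \<xi> \<in> tangent_space M (fst w)"
proof -
  obtain p u where pu: "w = (p, u)" "p \<in> points M" "u \<in> tangent_space M p"
    using w by (auto simp: points_tangent_bundle)
  obtain c where c: "c \<in> atlas M" "p \<in> fst c" using point_in_chart[OF pu(2)] .
  show ?thesis
    using connection_map_eq_chart_conn[OF c pu(3)] \<xi> chart_conn_in[of c w] c pu(1) by simp
qed

lemma connection_map_apply:
  assumes w: "w \<in> points (tangent_bundle M)" and \<xi>: "\<xi> \<in> tangent_space (tangent_bundle M) w"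
    and c: "c \<in> atlas M" "fst w \<in> fst c"
  shows "connection_map M nabla w \<xi> c =
    snd (\<xi> (tb_chart M c)) + christoffel c (snd c (fst w)) (fst (\<xi> (tb_chart M c))) (snd w c)"
proof -
  obtain p u where pu: "w = (p, u)" "u \<in> tangent_space M p"
    using w by (auto simp: points_tangent_bundle)
  show ?thesis
    using connection_map_eq_chart_conn[of c p u] \<xi> c pu by (simp add: chart_conn_def tvec_of_apply)
qed

lemma lincomb_apply: "lincomb a v b w c = a *\<^sub>R v c + b *\<^sub>R w c"
  by (simp add: lincomb_def)

lemma dproj_lincomb:
  assumes w: "w \<in> points (tangent_bundle M)"
    and \<xi>: "\<xi> \<in> tangent_space (tangent_bundle M) w" and \<eta>: "\<eta> \<in> tangent_space (tangent_bundle M) w"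
  shows "dproj M w (lincomb a \<xi> b \<eta>) = lincomb a (dproj M w \<xi>) b (dproj M w \<eta>)"
proof -
  have "fst w \<in> points M" using w by (auto simp: points_tangent_bundle)
  then obtain c where c: "c \<in> atlas M" "fst w \<in> fst c" by (rule point_in_chart)
  note l = TM.lincomb_in[OF \<xi> \<eta>, of a b]
  show ?thesis
    by (rule tangent_vector_eqI[OF dproj_eq(1)[OF w l] lincomb_in[OF dproj_eq(1)[OF w \<xi>] dproj_eq(1)[OF w \<eta>]] c])
       (simp add: lincomb_apply dproj_eq(2)[OF w l c] dproj_eq(2)[OF w \<xi> c] dproj_eq(2)[OF w \<eta> c])
qed

lemma connection_map_lincomb:
  assumes w: "w \<in> points (tangent_bundle M)"
    and \<xi>: "\<xi> \<in> tangent_space (tangent_bundle M) w" and \<eta>: "\<eta> \<in> tangent_space (tangent_bundle M) w"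
  shows "connection_map M nabla w (lincomb a \<xi> b \<eta>) =
    lincomb a (connection_map M nabla w \<xi>) b (connection_map M nabla w \<eta>)"
proof -
  obtain p u where pu: "w = (p, u)" "p \<in> points M" "u \<in> tangent_space M p"
    using w by (auto simp: points_tangent_bundle)
  obtain c where c: "c \<in> atlas M" "p \<in> fst c" using point_in_chart[OF pu(2)] .
  show ?thesis
    using connection_map_eq_chart_conn[OF c pu(3)] TM.lincomb_in[OF \<xi> \<eta>] \<xi> \<eta> pu(1) c
    by (simp add: chart_conn_lincomb)
qed

text \<open>In a chart the two maps form a triangular system: \<open>dproj\<close> gives the first
  component, and with it known \<open>connection_map\<close> gives the second.
  \<open>horizontal_vertical_exists\<close> solves the same system for given right-hand
  sides.\<close>

lemma horizontal_vertical_unique: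
  assumes w: "w \<in> points (tangent_bundle M)"
    and \<xi>: "\<xi> \<in> tangent_space (tangent_bundle M) w" and \<eta>: "\<eta> \<in> tangent_space (tangent_bundle M) w"
    and eq: "dproj M w \<xi> = dproj M w \<eta>" "connection_map M nabla w \<xi> = connection_map M nabla w \<eta>"
  shows "\<xi> = \<eta>"
proof -
  obtain p u where pu: "w = (p, u)" "p \<in> points M" "u \<in> tangent_space M p"
    using w by (auto simp: points_tangent_bundle)
  obtain c where c: "c \<in> atlas M" "p \<in> fst c" using point_in_chart[OF pu(2)] .
  have c': "fst w \<in> fst c" using c pu by simp
  have 1: "fst (\<xi> (tb_chart M c)) = fst (\<eta> (tb_chart M c))"
    using dproj_eq(2)[OF w \<xi> c(1) c'] dproj_eq(2)[OF w \<eta> c(1) c'] eq(1) by simp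
  moreover have "snd (\<xi> (tb_chart M c)) = snd (\<eta> (tb_chart M c))"
    using connection_map_apply[OF w \<xi> c(1) c'] connection_map_apply[OF w \<eta> c(1) c'] eq(2) 1 by simp
  ultimately have "\<xi> (tb_chart M c) = \<eta> (tb_chart M c)" by (simp add: prod_eq_iff)
  then show ?thesis
    by (intro TM.tangent_vector_eqI[OF \<xi> \<eta>, of "tb_chart M c"]) (use c pu in simp_all)
qed

lemma horizontal_vertical_exists:
  assumes w: "w \<in> points (tangent_bundle M)"
    and a: "a \<in> tangent_space M (fst w)" and k: "k \<in> tangent_space M (fst w)"
  shows "\<exists>\<xi>\<in>tangent_space (tangent_bundle M) w. dproj M w \<xi> = a \<and> connection_map M nabla w \<xi> = k"
proof -
  obtain p u where pu: "w = (p, u)" "p \<in> points M" "u \<in> tangent_space M p"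
    using w by (auto simp: points_tangent_bundle)
  obtain c where c: "c \<in> atlas M" "p \<in> fst c" using point_in_chart[OF pu(2)] .
  have c': "fst w \<in> fst c" using c pu by simp
  have C: "tb_chart M c \<in> atlas (tangent_bundle M)" "w \<in> fst (tb_chart M c)" using c pu by auto
  let ?\<xi> = "tvec_of (tangent_bundle M) (tb_chart M c) w (a c, k c - christoffel c (snd c p) (a c) (u c))"
  have \<xi>: "?\<xi> \<in> tangent_space (tangent_bundle M) w" by (rule TM.tvec_of_in[OF C])
  have val: "?\<xi> (tb_chart M c) = (a c, k c - christoffel c (snd c p) (a c) (u c))"
    by (rule TM.tvec_of_apply[OF C])
  have "dproj M w ?\<xi> = a"
    by (rule tangent_vector_eqI[OF dproj_eq(1)[OF w \<xi>] a c(1) c']) (simp add: dproj_eq(2)[OF w \<xi> c(1) c'] val)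
  moreover have "connection_map M nabla w ?\<xi> = k"
    by (rule tangent_vector_eqI[OF connection_map_in[OF w \<xi>] k c(1) c'])
       (use connection_map_apply[OF w \<xi> c(1) c'] val pu in simp)
  ultimately show ?thesis using \<xi> by blast
qed

text \<open>Unique existence behind both definite descriptions: the horizontal lift prescribes the
  pair \<open>X\<close>, \<open>tzero\<close>, the vertical lift the pair \<open>tzero\<close>,
  \<open>X\<close>.\<close>

lemma the_lift:
  assumes w: "w \<in> points (tangent_bundle M)"
    and a: "a \<in> tangent_space M (fst w)" and k: "k \<in> tangent_space M (fst w)"
  shows "\<exists>!\<xi>. \<xi> \<in> tangent_space (tangent_bundle M) w \<and> dproj M w \<xi> = a \<and> connection_map M nabla w \<xi> = k"
proof (rule ex_ex1I)
  show "\<exists>\<xi>. \<xi> \<in> tangent_space (tangent_bundle M) w \<and> dproj M w \<xi> = a \<and> connection_map M nabla w \<xi> = k"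
    using horizontal_vertical_exists[OF assms] by metis
  show "\<xi> = \<eta>"
    if "\<xi> \<in> tangent_space (tangent_bundle M) w \<and> dproj M w \<xi> = a \<and> connection_map M nabla w \<xi> = k"
      "\<eta> \<in> tangent_space (tangent_bundle M) w \<and> dproj M w \<eta> = a \<and> connection_map M nabla w \<eta> = k" for \<xi> \<eta>
    using that by (intro horizontal_vertical_unique[OF w]) simp_all
qed

lemma hlift:
  assumes "w \<in> points (tangent_bundle M)" "X (fst w) \<in> tangent_space M (fst w)"
  shows "hlift M nabla X w \<in> tangent_space (tangent_bundle M) w"
    and "dproj M w (hlift M nabla X w) = X (fst w)"
    and "connection_map M nabla w (hlift M nabla X w) = tzero"
  using theI'[OF the_lift[OF assms tzero_in], folded hlift_def] by simp_all

lemma vlift: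
  assumes "w \<in> points (tangent_bundle M)" "X (fst w) \<in> tangent_space M (fst w)"
  shows "vlift M nabla X w \<in> tangent_space (tangent_bundle M) w"
    and "dproj M w (vlift M nabla X w) = tzero"
    and "connection_map M nabla w (vlift M nabla X w) = X (fst w)"
  using theI'[OF the_lift[OF assms(1) tzero_in assms(2)], folded vlift_def] by simp_all

text \<open>Both sides have the same images under \<open>dproj\<close> and
  \<open>connection_map\<close>. The fields enter only through their values at
  \<open>fst w\<close>.\<close>

lemma lift_decomposition:
  assumes w: "w \<in> points (tangent_bundle M)" and \<xi>: "\<xi> \<in> tangent_space (tangent_bundle M) w"
    and X: "X (fst w) = dproj M w \<xi>" and Y: "Y (fst w) = connection_map M nabla w \<xi>"
  shows "\<xi> = lincomb 1 (hlift M nabla X w) 1 (vlift M nabla Y w)"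
proof -
  have Xt: "X (fst w) \<in> tangent_space M (fst w)" using dproj_eq(1)[OF w \<xi>] X by simp
  have Yt: "Y (fst w) \<in> tangent_space M (fst w)" using connection_map_in[OF w \<xi>] Y by simp
  note h = hlift[OF w, where X = X, OF Xt] and v = vlift[OF w, where X = Y, OF Yt]
  show ?thesis
    by (rule horizontal_vertical_unique[OF w \<xi> TM.lincomb_in[OF h(1) v(1)]])
       (use X Y in \<open>simp_all add: dproj_lincomb[OF w h(1) v(1)] connection_map_lincomb[OF w h(1) v(1)] h v,
          simp_all add: lincomb_def tzero_def\<close>)
qed

end


section \<open>The metric on the tangent bundle\<close>

definition lift_form ::
  "('a, 'e::euclidean_space) manifold \<Rightarrow> ('a \<Rightarrow> ('a, 'e) tvec \<Rightarrow> ('a, 'e) tvec \<Rightarrow> real) \<Rightarrow>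
   (('a \<Rightarrow> ('a, 'e) tvec) \<Rightarrow> ('a \<Rightarrow> ('a, 'e) tvec) \<Rightarrow> 'a \<Rightarrow> ('a, 'e) tvec) \<Rightarrow>
   real \<Rightarrow> real \<Rightarrow> real \<Rightarrow> 'a \<times> ('a, 'e) tvec \<Rightarrow>
   ('a \<times> ('a, 'e) tvec, 'e \<times> 'e) tvec \<Rightarrow> ('a \<times> ('a, 'e) tvec, 'e \<times> 'e) tvec \<Rightarrow> real" where
  "lift_form M g nabla m1 m2 m3 w \<xi> \<eta> =
     m1 * g (fst w) (dproj M w \<xi>) (dproj M w \<eta>) +
     m2 * (g (fst w) (dproj M w \<xi>) (connection_map M nabla w \<eta>) +
           g (fst w) (connection_map M nabla w \<xi>) (dproj M w \<eta>)) +
     m3 * g (fst w) (connection_map M nabla w \<xi>) (connection_map M nabla w \<eta>)"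

lemma sym_bilinear_onD:
  assumes "sym_bilinear_on V B"
  shows "v \<in> V \<Longrightarrow> w \<in> V \<Longrightarrow> B v w = B w v"
    and "v \<in> V \<Longrightarrow> v' \<in> V \<Longrightarrow> w \<in> V \<Longrightarrow> B (lincomb a v b v') w = a * B v w + b * B v' w"
  using assms unfolding sym_bilinear_on_def by blast+

locale riem_conn = affine_conn M nabla
  for M :: "('a, 'e::euclidean_space) manifold" and nabla +
  fixes g :: "'a \<Rightarrow> ('a, 'e) tvec \<Rightarrow> ('a, 'e) tvec \<Rightarrow> real"
  assumes metric: "riemannian_metric M g"
begin

interpretation TM: smooth_atlas "tangent_bundle M"
  by (rule smooth_atlas_tangent_bundle)

lemma g_sym_bilinear: "p \<in> points M \<Longrightarrow> sym_bilinear_on (tangent_space M p) (g p)"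
  using metric by (simp add: riemannian_metric_def)

lemmas g_sym = sym_bilinear_onD(1)[OF g_sym_bilinear]
  and g_left = sym_bilinear_onD(2)[OF g_sym_bilinear]

lemma g_right:
  assumes "p \<in> points M" "v \<in> tangent_space M p" "v' \<in> tangent_space M p" "w \<in> tangent_space M p"
  shows "g p w (lincomb a v b v') = a * g p w v + b * g p w v'"
  using assms g_left[of p v v' w a b] g_sym[of p w] lincomb_in[of v p v' a b] by simp

lemma g_tzero:
  assumes "p \<in> points M" "v \<in> tangent_space M p"
  shows "g p tzero v = 0" "g p v tzero = 0"
proof -
  have "lincomb 0 tzero 0 tzero = (tzero :: ('a, 'e) tvec)" by (simp add: lincomb_def tzero_def)
  then show "g p tzero v = 0"
    using g_left[OF assms(1) tzero_in tzero_in assms(2), of 0 0] by simp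
  then show "g p v tzero = 0" using g_sym[OF assms tzero_in] by simp
qed

lemma point_of_tb: "w \<in> points (tangent_bundle M) \<Longrightarrow> fst w \<in> points M"
  by (auto simp: points_tangent_bundle)

section \<open>Existence, uniqueness and positivity of the form\<close>

lemma lift_form_sym_bilinear:
  assumes w: "w \<in> points (tangent_bundle M)"
  shows "sym_bilinear_on (tangent_space (tangent_bundle M) w) (lift_form M g nabla m1 m2 m3 w)"
proof -
  note p = point_of_tb[OF w]
  note t = dproj_eq(1)[OF w] connection_map_in[OF w]
  show ?thesis
    unfolding sym_bilinear_on_def
  proof (intro conjI ballI allI)
    fix \<xi> \<eta> assume \<xi>: "\<xi> \<in> tangent_space (tangent_bundle M) w" and \<eta>: "\<eta> \<in> tangent_space (tangent_bundle M) w"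
    show "lift_form M g nabla m1 m2 m3 w \<xi> \<eta> = lift_form M g nabla m1 m2 m3 w \<eta> \<xi>"
      using g_sym[OF p t(1)[OF \<xi>] t(1)[OF \<eta>]] g_sym[OF p t(1)[OF \<xi>] t(2)[OF \<eta>]]
        g_sym[OF p t(2)[OF \<xi>] t(1)[OF \<eta>]] g_sym[OF p t(2)[OF \<xi>] t(2)[OF \<eta>]]
      by (simp add: lift_form_def)
    fix \<zeta> a b assume \<zeta>: "\<zeta> \<in> tangent_space (tangent_bundle M) w"
    show "lift_form M g nabla m1 m2 m3 w (lincomb a \<xi> b \<eta>) \<zeta> =
        a * lift_form M g nabla m1 m2 m3 w \<xi> \<zeta> + b * lift_form M g nabla m1 m2 m3 w \<eta> \<zeta>"
      by (simp add: lift_form_def dproj_lincomb[OF w \<xi> \<eta>] connection_map_lincomb[OF w \<xi> \<eta>]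
          g_left[OF p] t \<xi> \<eta> \<zeta> algebra_simps)
  qed
qed

text \<open>On a pair of lifts, all but one of the four \<open>g\<close> terms have an argument
  \<open>tzero\<close>.\<close>

lemma lift_metric_lift_form: "lift_metric M g nabla m1 m2 m3 (lift_form M g nabla m1 m2 m3)"
  unfolding lift_metric_def
proof (intro ballI allI impI conjI)
  fix w assume w: "w \<in> points (tangent_bundle M)"
  show "sym_bilinear_on (tangent_space (tangent_bundle M) w) (lift_form M g nabla m1 m2 m3 w)"
    by (rule lift_form_sym_bilinear[OF w])
  note p = point_of_tb[OF w]
  fix X Y assume XY: "vector_field M X" "vector_field M Y"
  have Xt: "X (fst w) \<in> tangent_space M (fst w)" and Yt: "Y (fst w) \<in> tangent_space M (fst w)"
    using XY p by (auto simp: vector_field_def)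
  note simps = lift_form_def hlift[OF w, where X = X, OF Xt] vlift[OF w, where X = X, OF Xt]
    hlift[OF w, where X = Y, OF Yt] vlift[OF w, where X = Y, OF Yt] g_tzero[OF p] Xt Yt tzero_in
  show "lift_form M g nabla m1 m2 m3 w (hlift M nabla X w) (hlift M nabla Y w) = m1 * g (fst w) (X (fst w)) (Y (fst w))"
    and "lift_form M g nabla m1 m2 m3 w (hlift M nabla X w) (vlift M nabla Y w) = m2 * g (fst w) (X (fst w)) (Y (fst w))"
    and "lift_form M g nabla m1 m2 m3 w (vlift M nabla X w) (vlift M nabla Y w) = m3 * g (fst w) (X (fst w)) (Y (fst w))"
    by (simp_all add: simps)
qed

text \<open>Both arguments are split into lifts of global vector fields, on which the values are
  prescribed; bilinearity does the rest.\<close>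

lemma lift_metric_eq_lift_form:
  assumes gbar: "lift_metric M g nabla m1 m2 m3 gbar" and w: "w \<in> points (tangent_bundle M)"
    and \<xi>: "\<xi> \<in> tangent_space (tangent_bundle M) w" and \<eta>: "\<eta> \<in> tangent_space (tangent_bundle M) w"
  shows "gbar w \<xi> \<eta> = lift_form M g nabla m1 m2 m3 w \<xi> \<eta>"
proof -
  note p = point_of_tb[OF w]
  note t = dproj_eq(1)[OF w] connection_map_in[OF w]
  obtain X where X: "vector_field M X" "X (fst w) = dproj M w \<xi>"
    using exists_vector_field[OF p t(1)[OF \<xi>]] by blast
  obtain Y where Y: "vector_field M Y" "Y (fst w) = connection_map M nabla w \<xi>"
    using exists_vector_field[OF p t(2)[OF \<xi>]] by blast
  obtain X' where X': "vector_field M X'" "X' (fst w) = dproj M w \<eta>"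
    using exists_vector_field[OF p t(1)[OF \<eta>]] by blast
  obtain Y' where Y': "vector_field M Y'" "Y' (fst w) = connection_map M nabla w \<eta>"
    using exists_vector_field[OF p t(2)[OF \<eta>]] by blast
  let ?h = "hlift M nabla X w" and ?v = "vlift M nabla Y w"
  let ?h' = "hlift M nabla X' w" and ?v' = "vlift M nabla Y' w"
  have tan: "?h \<in> tangent_space (tangent_bundle M) w" "?v \<in> tangent_space (tangent_bundle M) w"
    "?h' \<in> tangent_space (tangent_bundle M) w" "?v' \<in> tangent_space (tangent_bundle M) w"
    using t \<xi> \<eta> by (auto intro!: hlift(1)[OF w] vlift(1)[OF w] simp: X(2) Y(2) X'(2) Y'(2))
  have sb: "sym_bilinear_on (tangent_space (tangent_bundle M) w) (gbar w)"
    using gbar w by (auto simp: lift_metric_def)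
  note gs = sym_bilinear_onD(1)[OF sb] and gl = sym_bilinear_onD(2)[OF sb]
  have val: "gbar w (hlift M nabla X w) (hlift M nabla Y w) = m1 * g (fst w) (X (fst w)) (Y (fst w))"
    "gbar w (hlift M nabla X w) (vlift M nabla Y w) = m2 * g (fst w) (X (fst w)) (Y (fst w))"
    "gbar w (vlift M nabla X w) (vlift M nabla Y w) = m3 * g (fst w) (X (fst w)) (Y (fst w))"
    if "vector_field M X" "vector_field M Y" for X Y
    using gbar w that by (auto simp: lift_metric_def)
  have \<xi>eq: "\<xi> = lincomb 1 ?h 1 ?v" by (rule lift_decomposition[where X = X and Y = Y, OF w \<xi> X(2) Y(2)])
  have \<eta>eq: "\<eta> = lincomb 1 ?h' 1 ?v'" by (rule lift_decomposition[where X = X' and Y = Y', OF w \<eta> X'(2) Y'(2)])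
  have "gbar w \<xi> \<eta> = gbar w ?h \<eta> + gbar w ?v \<eta>"
    using gl[OF tan(1,2) \<eta>, of 1 1] by (simp flip: \<xi>eq)
  also have "gbar w ?h \<eta> = gbar w ?h ?h' + gbar w ?h ?v'"
    using gl[OF tan(3,4) tan(1), of 1 1] gs[OF tan(1) \<eta>] gs[OF tan(1,3)] gs[OF tan(1,4)] by (simp flip: \<eta>eq)
  \<comment> \<open>The mixed value is prescribed with the horizontal lift in first place, so
    symmetry turns the vertical-horizontal term around.\<close>
  also have "gbar w ?v \<eta> = gbar w ?h' ?v + gbar w ?v ?v'"
    using gl[OF tan(3,4) tan(2), of 1 1] gs[OF tan(2) \<eta>] gs[OF tan(2,4)] by (simp flip: \<eta>eq)
  finally show ?thesis
    using g_sym[OF p t(1)[OF \<eta>] t(2)[OF \<xi>]]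
    by (simp add: val X Y X' Y' lift_form_def algebra_simps)
qed

text \<open>Completing the square: \<open>m1\<close> times the form is \<open>g\<close> of
  \<open>m1 a + m2 k\<close> with itself plus \<open>(m1 * m3 - m2^2)\<close> times \<open>g\<close>
  of \<open>k\<close> with itself. Multiplying by \<open>m1\<close> first avoids division.\<close>

lemma lift_form_pos:
  assumes m: "m1 > 0" "m1 * m3 - m2\<^sup>2 > 0" and w: "w \<in> points (tangent_bundle M)"
    and \<xi>: "\<xi> \<in> tangent_space (tangent_bundle M) w" "\<xi> \<noteq> tzero"
  shows "lift_form M g nabla m1 m2 m3 w \<xi> \<xi> > 0"
proof -
  note p = point_of_tb[OF w]
  let ?g = "g (fst w)"
  define a where "a = dproj M w \<xi>"
  define k where "k = connection_map M nabla w \<xi>"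
  have a: "a \<in> tangent_space M (fst w)" and k: "k \<in> tangent_space M (fst w)"
    unfolding a_def k_def by (rule dproj_eq(1)[OF w \<xi>(1)], rule connection_map_in[OF w \<xi>(1)])
  have pos: "?g v v > 0" if "v \<in> tangent_space M (fst w)" "v \<noteq> tzero" for v
    using metric p that by (simp add: riemannian_metric_def)
  have nonneg: "?g v v \<ge> 0" if "v \<in> tangent_space M (fst w)" for v
    using pos[OF that] g_tzero(1)[OF p tzero_in] by (cases "v = tzero") auto
  let ?b = "lincomb m1 a m2 k"
  have b: "?b \<in> tangent_space M (fst w)" by (rule lincomb_in[OF a k])
  have "?g ?b ?b = m1 * (m1 * ?g a a + m2 * ?g a k) + m2 * (m1 * ?g k a + m2 * ?g k k)"
    using g_left[OF p a k b] g_right[OF p a k a] g_right[OF p a k k] by simp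
  then have key: "m1 * lift_form M g nabla m1 m2 m3 w \<xi> \<xi> = ?g ?b ?b + (m1 * m3 - m2\<^sup>2) * ?g k k"
    using g_sym[OF p a k] by (simp add: lift_form_def a_def[symmetric] k_def[symmetric] algebra_simps power2_eq_square)
  have "m1 * lift_form M g nabla m1 m2 m3 w \<xi> \<xi> > 0"
  proof (cases "k = tzero")
    case False
    then show ?thesis unfolding key using nonneg[OF b] pos[OF k] m(2) by (intro add_nonneg_pos mult_pos_pos) auto
  next
    case True
    \<comment> \<open>By injectivity of the pair (\<open>dproj\<close>,
      \<open>connection_map\<close>), a nonzero \<xi> with \<open>k = tzero\<close> has a nonzero
      horizontal part.\<close>
    have "a \<noteq> tzero"
    proof
      assume "a = tzero"
      \<comment> \<open>Writing \<open>tzero\<close> as a combination with coefficients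
        \<open>0\<close> shows that both linear maps send it to \<open>tzero\<close>.\<close>
      have z: "lincomb 0 \<xi> 0 \<xi> = tzero" "lincomb 0 a 0 a = tzero" "lincomb 0 k 0 k = tzero"
        by (simp_all add: lincomb_def tzero_def)
      have "\<xi> = tzero"
        by (rule horizontal_vertical_unique[OF w \<xi>(1) TM.tzero_in])
           (use dproj_lincomb[OF w \<xi>(1) \<xi>(1), of 0 0] connection_map_lincomb[OF w \<xi>(1) \<xi>(1), of 0 0]
             \<open>a = tzero\<close> True z in \<open>simp_all flip: a_def k_def\<close>)
      with \<xi>(2) show False by simp
    qed
    then obtain d where d: "a d \<noteq> 0" unfolding tzero_def by metis
    have "?b d = m1 *\<^sub>R a d" using True by (simp add: lincomb_def tzero_def)
    then have "?b \<noteq> tzero" using d m(1) by (auto simp: tzero_def dest: fun_cong[of _ _ d])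
    then have "?g ?b ?b > 0" by (rule pos[OF b])
    moreover have "?g k k = 0" using True g_tzero(1)[OF p tzero_in] by simp
    ultimately show ?thesis unfolding key by simp
  qed
  then show ?thesis using m(1) by (simp add: zero_less_mult_iff)
qed

section \<open>Smoothness of the form in coordinates\<close>

definition gcoord :: "('a, 'e) chart \<Rightarrow> 'e \<Rightarrow> 'e \<Rightarrow> 'e \<Rightarrow> real" where
  "gcoord c x a b = g (chart_inv c x) (tvec_of M c (chart_inv c x) a) (tvec_of M c (chart_inv c x) b)"

lemma bilinear_gcoord:
  assumes c: "c \<in> atlas M" and x: "x \<in> cdom c"
  shows "bilinear (gcoord c x)"
proof -
  let ?q = "chart_inv c x"
  have q: "?q \<in> fst c" by (rule chart_inv_in[OF x])
  note p = chart_in_points[OF c q] and t = tvec_of_in[OF c q]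
  have l: "gcoord c x (\<alpha> *\<^sub>R a + \<beta> *\<^sub>R b) d = \<alpha> * gcoord c x a d + \<beta> * gcoord c x b d"
    and r: "gcoord c x d (\<alpha> *\<^sub>R a + \<beta> *\<^sub>R b) = \<alpha> * gcoord c x d a + \<beta> * gcoord c x d b" for \<alpha> \<beta> a b d
    by (simp_all add: gcoord_def tvec_of_lincomb[OF c q] g_left[OF p t t t] g_right[OF p t t t])
  show ?thesis
    unfolding bilinear_def linear_iff
    using l[of 1 _ 1] l[of _ _ 0] r[of _ 1 _ 1] r[of _ _ _ 0] by simp
qed

lemma smooth_gcoord:
  assumes c: "c \<in> atlas M"
  shows "smooth_on (\<lambda>x. gcoord c x a b) (cdom c)"
proof (rule smooth_on_locally)
  fix x assume x: "x \<in> cdom c"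
  obtain \<beta> :: "'e \<Rightarrow> real" and V where \<beta>: "smooth_on \<beta> (cdom c)" "csupp_on \<beta> (cdom c)"
    "open V" "snd c (chart_inv c x) \<in> V" "V \<subseteq> cdom c" "\<And>x. x \<in> V \<Longrightarrow> \<beta> x = 1"
    using exists_bump_at[OF c chart_inv_in[OF x]] by blast
  have "cutoff c \<beta> V" using \<beta> by (simp add: cutoff_def)
  then have "smooth_fun M (\<lambda>q. g q (frame c \<beta> a q) (frame c \<beta> b q))"
    using metric vector_field_frame[OF c] by (simp add: riemannian_metric_def)
  then have "smooth_on ((\<lambda>q. g q (frame c \<beta> a q) (frame c \<beta> b q)) \<circ> chart_inv c) V"
    using c \<beta>(5) by (auto simp: smooth_fun_def intro: smooth_on_subset)
  then have "smooth_on (\<lambda>x. gcoord c x a b) V"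
    by (rule smooth_on_cong[OF \<beta>(3), rotated])
       (use \<beta>(5,6) in \<open>auto simp: gcoord_def lift_field_def chart_inv_in chart_chart_inv subset_iff\<close>)
  then show "\<exists>T. open T \<and> x \<in> T \<and> smooth_on (\<lambda>x. gcoord c x a b) T"
    using \<beta>(3,4) chart_chart_inv[OF x] by auto
qed

lemma g_eq_gcoord:
  assumes c: "c \<in> atlas M" "p \<in> fst c" and v: "v \<in> tangent_space M p" "v' \<in> tangent_space M p"
  shows "g p v v' = gcoord c (snd c p) (v c) (v' c)"
  by (simp add: gcoord_def chart_inv_chart c tvec_of_tangent v)

lemma smooth_fun_lift_form:
  assumes X: "vector_field (tangent_bundle M) X" and Y: "vector_field (tangent_bundle M) Y"
  shows "smooth_fun (tangent_bundle M) (\<lambda>w. lift_form M g nabla m1 m2 m3 w (X w) (Y w))"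
  unfolding smooth_fun_def
proof
  fix C assume C: "C \<in> atlas (tangent_bundle M)"
  then obtain c where c: "C = tb_chart M c" "c \<in> atlas M" by auto
  let ?S = "cdom c \<times> (UNIV :: 'e set)"
  have dom: "cdom C = ?S" using c by (simp add: cdom_tb_chart del: fst_tb_chart)
  have o: "open ?S" using open_cdom[OF c(2)] by (intro open_Times open_UNIV)
  have proj: "smooth_on (\<lambda>z::'e \<times> 'e. fst z) ?S" "smooth_on (\<lambda>z::'e \<times> 'e. snd z) ?S"
    by (rule smooth_on_bounded_linear[OF _ o smooth_on_id[OF o]];
        simp add: bounded_linear_fst bounded_linear_snd)+
  \<comment> \<open>For \<open>z = (x, y)\<close>, with \<open>y\<close> the fibre coordinate of the
    point, \<open>h\<close> and \<open>k\<close> are the coordinates of \<open>dproj\<close> and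
    \<open>connection_map\<close> applied to the field; both are smooth in \<open>z\<close>,
    although \<open>christoffel\<close> is controlled only for fixed arguments.\<close>
  define h where "h Z z = fst (coord C Z z)" for Z z
  define k where "k Z z = snd (coord C Z z) + christoffel c (fst z) (h Z z) (snd z)" for Z z
  have base: "smooth_on (\<lambda>z. F (fst z)) ?S" if "smooth_on F (cdom c)" for F :: "'e \<Rightarrow> 'z::real_normed_vector"
    by (rule smooth_on_compose[OF o open_cdom[OF c(2)] _ proj(1) that]) auto
  have coordZ: "smooth_on (coord C Z) ?S" if "vector_field (tangent_bundle M) Z" for Z
    using TM.smooth_field_coord[OF TM.vector_field_imp_smooth_field[OF that] C] dom by simp
  have h: "smooth_on (h Z) ?S" if "vector_field (tangent_bundle M) Z" for Z
    unfolding h_def[abs_def] by (rule smooth_on_bounded_linear[OF bounded_linear_fst o coordZ[OF that]])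
  have k: "smooth_on (k Z) ?S" if Z: "vector_field (tangent_bundle M) Z" for Z
    unfolding k_def[abs_def]
  proof (rule smooth_on_add[OF o])
    show "smooth_on (\<lambda>z. snd (coord C Z z)) ?S"
      by (rule smooth_on_bounded_linear[OF bounded_linear_snd o coordZ[OF Z]])
    show "smooth_on (\<lambda>z. christoffel c (fst z) (h Z z) (snd z)) ?S"
      by (rule smooth_on_bilinear_family[OF o _ _ h[OF Z] proj(2)])
         (auto intro!: bilinear_christoffel base smooth_christoffel c(2))
  qed
  have G: "smooth_on (\<lambda>z. gcoord c (fst z) (a z) (b z)) ?S" if "smooth_on a ?S" "smooth_on b ?S" for a b
    by (rule smooth_on_bilinear_family[OF o _ _ that])
       (auto intro!: bilinear_gcoord base smooth_gcoord c(2))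
  have "smooth_on (\<lambda>z. m1 * gcoord c (fst z) (h X z) (h Y z) +
      m2 * (gcoord c (fst z) (h X z) (k Y z) + gcoord c (fst z) (k X z) (h Y z)) +
      m3 * gcoord c (fst z) (k X z) (k Y z)) ?S"
    by (intro smooth_on_add smooth_on_bounded_linear[OF bounded_linear_mult_right] G h k o X Y)
  moreover have "m1 * gcoord c (fst z) (h X z) (h Y z) +
      m2 * (gcoord c (fst z) (h X z) (k Y z) + gcoord c (fst z) (k X z) (h Y z)) +
      m3 * gcoord c (fst z) (k X z) (k Y z) =
      ((\<lambda>w. lift_form M g nabla m1 m2 m3 w (X w) (Y w)) \<circ> chart_inv C) z" if z: "z \<in> ?S" for z
  proof -
    let ?w = "chart_inv C z"
    have zC: "z \<in> cdom C" using z dom by simp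
    have w: "?w \<in> points (tangent_bundle M)"
      using chart_inv_in[OF zC] TM.chart_in_points[of C] c by simp
    have z1: "fst z \<in> cdom c" using z by auto
    have "?w = chart_inv (tb_chart M c) (fst z, snd z)" using c by simp
    also have "\<dots> = (chart_inv c (fst z), tvec_of M c (chart_inv c (fst z)) (snd z))"
      by (rule chart_inv_tb[OF c(2) z1])
    finally have weq: "fst ?w = chart_inv c (fst z)" "snd ?w = tvec_of M c (chart_inv c (fst z)) (snd z)"
      by simp_all
    have wc: "fst ?w \<in> fst c" "snd c (fst ?w) = fst z" "snd ?w c = snd z"
      using weq z1 c(2) by (simp_all add: chart_inv_in chart_chart_inv tvec_of_apply)
    have Zt: "Z ?w \<in> tangent_space (tangent_bundle M) ?w" if "vector_field (tangent_bundle M) Z" for Z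
      using that w by (simp add: vector_field_def)
    have hk: "dproj M ?w (Z ?w) \<in> tangent_space M (fst ?w)" "dproj M ?w (Z ?w) c = h Z z"
      "connection_map M nabla ?w (Z ?w) \<in> tangent_space M (fst ?w)" "connection_map M nabla ?w (Z ?w) c = k Z z"
      if "vector_field (tangent_bundle M) Z" for Z
      using dproj_eq[OF w Zt[OF that]] connection_map_in[OF w Zt[OF that]]
        connection_map_apply[OF w Zt[OF that] c(2) wc(1)] wc c
      by (simp_all add: h_def k_def coord_def)
    show ?thesis
      by (simp add: lift_form_def g_eq_gcoord[OF c(2) wc(1)] hk X Y wc(2))
  qed
  ultimately show "smooth_on ((\<lambda>w. lift_form M g nabla m1 m2 m3 w (X w) (Y w)) \<circ> chart_inv C) (cdom C)"
    unfolding dom by (rule smooth_on_cong[OF o, rotated]) 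
qed

theorem lift_metric_riemannian:
  assumes m: "m1 > 0" "m1 * m3 - m2\<^sup>2 > 0" and gbar: "lift_metric M g nabla m1 m2 m3 gbar"
  shows "riemannian_metric (tangent_bundle M) gbar"
  unfolding riemannian_metric_def
proof (intro conjI ballI allI impI)
  show "sym_bilinear_on (tangent_space (tangent_bundle M) w) (gbar w)"
    if "w \<in> points (tangent_bundle M)" for w
    using gbar that by (simp add: lift_metric_def)
  show "gbar w \<xi> \<xi> > 0"
    if "w \<in> points (tangent_bundle M)" "\<xi> \<in> tangent_space (tangent_bundle M) w" "\<xi> \<noteq> tzero" for w \<xi>
    using lift_form_pos[OF m that] lift_metric_eq_lift_form[OF gbar that(1,2,2)] by simp
  fix X Y assume XY: "vector_field (tangent_bundle M) X" "vector_field (tangent_bundle M) Y"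
  show "smooth_fun (tangent_bundle M) (\<lambda>w. gbar w (X w) (Y w))"
    unfolding smooth_fun_def
  proof
    \<comment> \<open>\<open>gbar\<close> is determined only on tangent vectors at points of the
      bundle, so the two functions are compared inside a chart, where \<open>chart_inv C z\<close>
      is such a point.\<close>
    fix C assume C: "C \<in> atlas (tangent_bundle M)"
    have "smooth_on ((\<lambda>w. lift_form M g nabla m1 m2 m3 w (X w) (Y w)) \<circ> chart_inv C) (cdom C)"
      using smooth_fun_lift_form[OF XY] C unfolding smooth_fun_def by blast
    moreover have "((\<lambda>w. lift_form M g nabla m1 m2 m3 w (X w) (Y w)) \<circ> chart_inv C) z =
        ((\<lambda>w. gbar w (X w) (Y w)) \<circ> chart_inv C) z" if "z \<in> cdom C" for z
    proof -
      have w: "chart_inv C z \<in> points (tangent_bundle M)"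
        by (rule TM.chart_in_points[OF C chart_inv_in[OF that]])
      then show ?thesis
        using XY by (simp add: lift_metric_eq_lift_form[OF gbar w] vector_field_def)
    qed
    ultimately show "smooth_on ((\<lambda>w. gbar w (X w) (Y w)) \<circ> chart_inv C) (cdom C)"
      by (rule smooth_on_cong[OF TM.open_cdom[OF C], rotated])
  qed
qed

end

text \<open>The metric is given by conditions that leave \<open>gbar\<close> free off the tangent
  spaces; hence the claim for every such \<open>gbar\<close>, while the existence clause keeps it
  from being vacuous.\<close>

theorem proposition3p1:
  fixes M :: "('a, 'e::euclidean_space) manifold"
    and g :: "'a \<Rightarrow> ('a, 'e) tvec \<Rightarrow> ('a, 'e) tvec \<Rightarrow> real"
    and nabla :: "('a \<Rightarrow> ('a, 'e) tvec) \<Rightarrow> ('a \<Rightarrow> ('a, 'e) tvec) \<Rightarrow> 'a \<Rightarrow> ('a, 'e) tvec"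
    and m1 m2 m3 :: real
  assumes "riemannian_manifold M g"
    and "levi_civita M g nabla"
    and "m1 > 0" and "m3 > 0" and "m1 * m3 - m2\<^sup>2 > 0"
  shows "(\<exists>gbar. lift_metric M g nabla m1 m2 m3 gbar) \<and>
    (\<forall>gbar. lift_metric M g nabla m1 m2 m3 gbar \<longrightarrow> riemannian_metric (tangent_bundle M) gbar)"
proof -
  interpret riem_conn M nabla g
    using assms(1,2) by unfold_locales (auto simp: riemannian_manifold_def levi_civita_def)
  show ?thesis
    using lift_metric_lift_form lift_metric_riemannian[OF assms(3,5)] by blast
qed

end
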